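(* Let $M$ be a matroid of rank at most four and $B_0$ any basis. Then every dead pair (dead stratum with two elements) admits an unconditional fibre, and every dead triple (dead stratum with three elements) admits a fibre, whatever fibres have been chosen at the dead strata strictly inside it. Consequently, for every basis $B_0$ of a matroid $M$ of rank at most four, $(M,B_0)$ carries a fibre system, and Stanley's conjecture holds for these matroids, i.e. $h(M)$ is a pure $O$-sequence.
   Context: $M$ is a matroid on a finite ground set $E$, $R=E\setminus B_0$. For $i\in R$, $C_i$ is the fundamental circuit, the unique circuit in $B_0\cup\{i\}$. For $\sigma\subseteq R$ put $m_\sigma(e)=\#\{i\in\sigma:e\in C_i\}$, $U_\sigma=\{e:m_\sigma(e)=1\}$, $A_\sigma=\{e:m_\sigma(e)\ge1\}$. A stratum is a nonempty $\sigma\subseteq R$; it is dead if $U_\sigma$ is independent in $M$, live otherwise. The baseline $b_\sigma\in\mathbb N^\sigma$ is $b_\sigma(i)=|C_i\cap U_\sigma|$; $\mathbb N^\sigma$ is identified with the vectors in $\mathbb N^R$ vanishing outside $\sigma$. $\sigma$ can be fired from $a\in\mathbb N^R$ if $a_i\ge b_\sigma(i)$ for all $i\in\sigma$. For dead $\sigma$, the dead node is $K_\sigma=(M|A_\sigma)/U_\sigma$. For a matroid $N$ of rank $d$, $h(N)=(h_0,\dots,h_d)$ is the $h$-vector of its independence complex: $T_N(x,1)=\sum_kh_kx^{d-k}$. A multicomplex is a finite set of monomials (exponent vectors) closed under division; it is pure if all maximal elements have the same degree $|a|=\sum a_i$; its degree sequence counts elements of each degree (trailing zeros ignored). A pure $O$-sequence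 is the degree sequence of a pure multicomplex. Fibres (recursively along inclusion): given fibres $F(\tau)$ at all dead $\tau\subsetneq\sigma$, a fibre at a dead stratum $\sigma$ is a set $F(\sigma)\subseteq\mathbb N^\sigma$ such that (i) $F(\sigma)$ is a pure multicomplex with degree sequence $h(K_\sigma)$; (ii) for every $m\in F(\sigma)$, every stratum $\tau\subsetneq\sigma$ that can be fired from $b_\sigma+m$ is dead with $(b_\sigma+m)|_\tau-b_\tau\in F(\tau)$. An unconditional fibre at $\sigma$ is a set satisfying (i) such that for every $m\in F(\sigma)$, every stratum $\tau\subsetneq\sigma$ that can be fired from $b_\sigma+m$ is dead with $(b_\sigma+m)|_\tau=b_\tau$. A fibre system on $(M,B_0)$ is a choice of a fibre at every dead stratum. *)

theory Defs
  imports "HOL-Computational_Algebra.Polynomial"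
begin

section \<open>Matroids\<close>

record 'a matroid_data =
  ground :: "'a set"
  indep :: "'a set \<Rightarrow> bool"

locale matroid =
  fixes M :: "'a matroid_data"
  assumes finite_ground: "finite (ground M)"
    and indep_subset_ground: "indep M X \<Longrightarrow> X \<subseteq> ground M"
    and indep_empty: "indep M {}"
    and indep_mono: "indep M Y \<Longrightarrow> X \<subseteq> Y \<Longrightarrow> indep M X"
    and augment: "indep M X \<Longrightarrow> indep M Y \<Longrightarrow> card X < card Y \<Longrightarrow>
      \<exists>e\<in>Y - X. indep M (insert e X)"

definition basis_of :: "'a matroid_data \<Rightarrow> 'a set \<Rightarrow> 'a set \<Rightarrow> bool" where
  "basis_of M X B \<longleftrightarrow> B \<subseteq> X \<and> indep M B \<and> (\<forall>I. I \<subseteq> X \<and> indep M I \<and> B \<subseteq> I \<longrightarrow> I = B)"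

abbreviation basis :: "'a matroid_data \<Rightarrow> 'a set \<Rightarrow> bool" where
  "basis M B \<equiv> basis_of M (ground M) B"

definition circuit :: "'a matroid_data \<Rightarrow> 'a set \<Rightarrow> bool" where
  "circuit M C \<longleftrightarrow> C \<subseteq> ground M \<and> \<not> indep M C \<and> (\<forall>D. D \<subset> C \<longrightarrow> indep M D)"

definition rank_of :: "'a matroid_data \<Rightarrow> 'a set \<Rightarrow> nat" where
  "rank_of M X = Max (card ` {I. I \<subseteq> X \<and> indep M I})"

abbreviation rank :: "'a matroid_data \<Rightarrow> nat" where
  "rank M \<equiv> rank_of M (ground M)"

text \<open>Restriction \<open>M | A\<close> (for \<open>A\<close> contained in the ground set) and contraction \<open>M / T\<close>.\<close>

definition restriction :: "'a matroid_data \<Rightarrow> 'a set \<Rightarrow> 'a matroid_data" where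
  "restriction M A = \<lparr>ground = A, indep = (\<lambda>X. X \<subseteq> A \<and> indep M X)\<rparr>"

definition contraction :: "'a matroid_data \<Rightarrow> 'a set \<Rightarrow> 'a matroid_data" where
  "contraction M T = \<lparr>ground = ground M - T,
     indep = (\<lambda>X. X \<subseteq> ground M - T \<and> (\<exists>B. basis_of M T B \<and> indep M (X \<union> B)))\<rparr>"


section \<open>The Tutte polynomial and the h-vector\<close>

text \<open>The Tutte polynomial \<open>T(x, y)\<close> as a polynomial in \<open>y\<close> whose coefficients are polynomials
  in \<open>x\<close>: the first factor is a power of \<open>x - 1\<close>, the second a power of \<open>y - 1\<close>.\<close>

definition tutte :: "'a matroid_data \<Rightarrow> int poly poly" where
  "tutte M = (\<Sum>A\<in>Pow (ground M).
     [:[:-1, 1:]:] ^ (rank M - rank_of M A) * [:-1, 1:] ^ (card A - rank_of M A))"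

text \<open>\<open>T(x, 1) = (\<Sum>k\<le>d. h k * x ^ (d - k))\<close>, where \<open>d\<close> is the rank; the sequence is padded with
  zeros, so that equality of sequences ignores trailing zeros.\<close>

definition h_vector :: "'a matroid_data \<Rightarrow> nat \<Rightarrow> int" where
  "h_vector M k = (if k \<le> rank M then coeff (poly (tutte M) 1) (rank M - k) else 0)"


section \<open>Multicomplexes and pure O-sequences\<close>

text \<open>A monomial in the variables \<open>V\<close> is an exponent vector vanishing outside \<open>V\<close>; divisibility is
  the pointwise order on functions.\<close>

definition monomials :: "'v set \<Rightarrow> ('v \<Rightarrow> nat) set" where
  "monomials V = {a. \<forall>i. i \<notin> V \<longrightarrow> a i = 0}"

definition multicomplex :: "'v set \<Rightarrow> ('v \<Rightarrow> nat) set \<Rightarrow> bool" where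
  "multicomplex V S \<longleftrightarrow> finite S \<and> S \<subseteq> monomials V \<and> (\<forall>a\<in>S. \<forall>b. b \<le> a \<longrightarrow> b \<in> S)"

definition maximal_monomial :: "('v \<Rightarrow> nat) set \<Rightarrow> ('v \<Rightarrow> nat) \<Rightarrow> bool" where
  "maximal_monomial S a \<longleftrightarrow> a \<in> S \<and> (\<forall>b\<in>S. a \<le> b \<longrightarrow> b = a)"

definition pure_multicomplex :: "'v set \<Rightarrow> ('v \<Rightarrow> nat) set \<Rightarrow> bool" where
  "pure_multicomplex V S \<longleftrightarrow> multicomplex V S \<and>
     (\<forall>a b. maximal_monomial S a \<and> maximal_monomial S b \<longrightarrow> sum a V = sum b V)"

definition degree_sequence :: "'v set \<Rightarrow> ('v \<Rightarrow> nat) set \<Rightarrow> nat \<Rightarrow> int" where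
  "degree_sequence V S k = int (card {a \<in> S. sum a V = k})"

definition pure_O_sequence :: "(nat \<Rightarrow> int) \<Rightarrow> bool" where
  "pure_O_sequence h \<longleftrightarrow>
     (\<exists>(n::nat) S. pure_multicomplex {..<n} S \<and> degree_sequence {..<n} S = h)"


section \<open>Strata\<close>

definition fundamental_circuit :: "'a matroid_data \<Rightarrow> 'a set \<Rightarrow> 'a \<Rightarrow> 'a set" where
  "fundamental_circuit M B0 i = (THE C. circuit M C \<and> C \<subseteq> insert i B0)"

definition multiplicity :: "'a matroid_data \<Rightarrow> 'a set \<Rightarrow> 'a set \<Rightarrow> 'a \<Rightarrow> nat" where
  "multiplicity M B0 \<sigma> e = card {i \<in> \<sigma>. e \<in> fundamental_circuit M B0 i}"

definition U_set :: "'a matroid_data \<Rightarrow> 'a set \<Rightarrow> 'a set \<Rightarrow> 'a set" where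
  "U_set M B0 \<sigma> = {e \<in> ground M. multiplicity M B0 \<sigma> e = 1}"

definition A_set :: "'a matroid_data \<Rightarrow> 'a set \<Rightarrow> 'a set \<Rightarrow> 'a set" where
  "A_set M B0 \<sigma> = {e \<in> ground M. multiplicity M B0 \<sigma> e \<ge> 1}"

definition stratum :: "'a matroid_data \<Rightarrow> 'a set \<Rightarrow> 'a set \<Rightarrow> bool" where
  "stratum M B0 \<sigma> \<longleftrightarrow> \<sigma> \<noteq> {} \<and> \<sigma> \<subseteq> ground M - B0"

definition dead :: "'a matroid_data \<Rightarrow> 'a set \<Rightarrow> 'a set \<Rightarrow> bool" where
  "dead M B0 \<sigma> \<longleftrightarrow> stratum M B0 \<sigma> \<and> indep M (U_set M B0 \<sigma>)"

definition baseline :: "'a matroid_data \<Rightarrow> 'a set \<Rightarrow> 'a set \<Rightarrow> 'a \<Rightarrow> nat" where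
  "baseline M B0 \<sigma> i =
     (if i \<in> \<sigma> then card (fundamental_circuit M B0 i \<inter> U_set M B0 \<sigma>) else 0)"

definition can_be_fired :: "'a matroid_data \<Rightarrow> 'a set \<Rightarrow> 'a set \<Rightarrow> ('a \<Rightarrow> nat) \<Rightarrow> bool" where
  "can_be_fired M B0 \<sigma> a \<longleftrightarrow> (\<forall>i\<in>\<sigma>. a i \<ge> baseline M B0 \<sigma> i)"

definition dead_node :: "'a matroid_data \<Rightarrow> 'a set \<Rightarrow> 'a set \<Rightarrow> 'a matroid_data" where
  "dead_node M B0 \<sigma> = contraction (restriction M (A_set M B0 \<sigma>)) (U_set M B0 \<sigma>)"


section \<open>Fibres\<close>

definition vec_restrict :: "('a \<Rightarrow> nat) \<Rightarrow> 'a set \<Rightarrow> 'a \<Rightarrow> nat" where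
  "vec_restrict a \<tau> i = (if i \<in> \<tau> then a i else 0)"

text \<open>Condition (i), including \<open>S \<subseteq> \<nat>\<^sup>\<sigma>\<close>.\<close>

definition fibre_shape :: "'a matroid_data \<Rightarrow> 'a set \<Rightarrow> 'a set \<Rightarrow> ('a \<Rightarrow> nat) set \<Rightarrow> bool" where
  "fibre_shape M B0 \<sigma> S \<longleftrightarrow>
     pure_multicomplex \<sigma> S \<and> degree_sequence \<sigma> S = h_vector (dead_node M B0 \<sigma>)"

text \<open>\<open>fibre M B0 F \<sigma> S\<close>: the set \<open>S\<close> is a fibre at the dead stratum \<open>\<sigma>\<close>, relative to the fibres \<open>F \<tau>\<close>
  chosen at the dead strata \<open>\<tau> \<subset> \<sigma>\<close>; other values of \<open>F\<close> are irrelevant. The subtraction is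
  never truncated, since \<open>\<tau>\<close> can be fired.\<close>

definition fibre ::
  "'a matroid_data \<Rightarrow> 'a set \<Rightarrow> ('a set \<Rightarrow> ('a \<Rightarrow> nat) set) \<Rightarrow> 'a set \<Rightarrow> ('a \<Rightarrow> nat) set \<Rightarrow> bool" where
  "fibre M B0 F \<sigma> S \<longleftrightarrow> dead M B0 \<sigma> \<and> fibre_shape M B0 \<sigma> S \<and>
     (\<forall>m\<in>S. \<forall>\<tau>. let a = (\<lambda>i. baseline M B0 \<sigma> i + m i) in
        stratum M B0 \<tau> \<and> \<tau> \<subset> \<sigma> \<and> can_be_fired M B0 \<tau> a \<longrightarrow>
        dead M B0 \<tau> \<and> (\<lambda>i. vec_restrict a \<tau> i - baseline M B0 \<tau> i) \<in> F \<tau>)"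

definition unconditional_fibre ::
  "'a matroid_data \<Rightarrow> 'a set \<Rightarrow> 'a set \<Rightarrow> ('a \<Rightarrow> nat) set \<Rightarrow> bool" where
  "unconditional_fibre M B0 \<sigma> S \<longleftrightarrow> dead M B0 \<sigma> \<and> fibre_shape M B0 \<sigma> S \<and>
     (\<forall>m\<in>S. \<forall>\<tau>. let a = (\<lambda>i. baseline M B0 \<sigma> i + m i) in
        stratum M B0 \<tau> \<and> \<tau> \<subset> \<sigma> \<and> can_be_fired M B0 \<tau> a \<longrightarrow>
        dead M B0 \<tau> \<and> vec_restrict a \<tau> = baseline M B0 \<tau>)"

definition fibre_system ::
  "'a matroid_data \<Rightarrow> 'a set \<Rightarrow> ('a set \<Rightarrow> ('a \<Rightarrow> nat) set) \<Rightarrow> bool" where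
  "fibre_system M B0 F \<longleftrightarrow> (\<forall>\<sigma>. dead M B0 \<sigma> \<longrightarrow> fibre M B0 F \<sigma> (F \<sigma>))"

end

theory Submission
  imports Defs
begin

text \<open>
  Write \<open>R\<close> for the complement of \<open>B0\<close>. Suppose that a fibre system \<open>F\<close> is given, and let \<open>S\<close>
  be the set of all vectors \<open>a\<close> on \<open>R\<close> such that every stratum that can be fired from \<open>a\<close> is dead and
  leaves a remainder in its fibre. Then \<open>S\<close> is a pure multicomplex with degree sequence \<open>h(M)\<close>; this
  is \<open>fibre_system_imp_pure_O_sequence\<close>, valid in every rank. The reason is that deletion and
  contraction run in step with the burning algorithm for parking functions.
  On the matroid side stands the polynomial \<open>minor_poly\<close>, which is \<open>t\<close> to the power \<open>|V|\<close> times the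
  h-polynomial of \<open>(M|X)/V\<close>, and zero if \<open>V\<close> is dependent. Start with \<open>X = A \<sigma>\<close> and a subset \<open>W\<close> of
  \<open>U \<sigma>\<close>, and let \<open>e\<close> be a further element of \<open>U \<sigma>\<close>, lying on the circuit \<open>C i\<close> alone. Contracting \<open>e\<close>
  enlarges \<open>W\<close>. Deleting \<open>e\<close> destroys \<open>C i\<close>: the other elements that only \<open>C i\<close> covers become
  coloops and can be discarded, and what remains is \<open>A (\<sigma> - {i})\<close> (\<open>minor_poly_burn\<close>). On the side of \<open>S\<close>, let
  the number of elements of \<open>W\<close> on \<open>C i\<close> be a lower bound for the coordinate \<open>a i\<close>. Either \<open>a i\<close>
  exceeds the bound, or it equals it; in the second case \<open>a i\<close> is below the baseline of \<open>\<sigma>\<close>, hence below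
  that of every smaller stratum, so \<open>i\<close> takes part in no firing and can be removed from \<open>\<sigma>\<close>
  (\<open>generating_poly_slice_burn\<close>). The two recursions agree, and they end when \<open>W = U \<sigma>\<close>, that is, when \<open>\<sigma>\<close> can
  be fired. There both sides are zero if \<open>\<sigma>\<close> is live, and for dead \<open>\<sigma>\<close> they agree by the defining property
  of a fibre. Purity follows from the same process: a burnt coordinate can be raised to one less than
  its baseline, and a fibre can be filled up to the rank of its dead node, because \<open>A \<sigma>\<close> is a union
  of circuits, so that the dead node has no coloops and its h-vector does not end early.

  It remains to find fibres in rank at most four. With \<open>Q = A \<sigma> - U \<sigma>\<close>, a subset of \<open>B0\<close>, the dead node
  at \<open>\<sigma>\<close> has ground set \<open>Q\<close> and rank \<open>|Q| - |\<sigma>|\<close>. If this is zero, the fibre consists of the zero vector,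
  and firing exactly at the baseline is always harmless (\<open>fired_at_baseline\<close>). Single-element strata are
  live, since a circuit is dependent, so this settles everything except pairs with \<open>|Q| \<le> 4\<close>
  and triples with \<open>|Q| = 4\<close>. For a pair the node has rank at most two and nullity two, its h-vector
  satisfies Macaulay's bound in two variables, and no proper stratum can be fired, since both
  circuits contain \<open>Q\<close> (\<open>dead_pair_unconditional_fibre\<close>). For a triple with \<open>Q = B0\<close> the node has rank
  one, and its fibre consists of \<open>0\<close> and as many unit vectors as there are elements of \<open>B0\<close> outside
  the closure of \<open>\<sigma>\<close>, less one. A unit vector may be blocked by a smaller stratum \<open>\<tau>\<close>, but \<open>\<tau>\<close> blocks no
  more of them than there are \<open>x\<close> in \<open>B0\<close> for which \<open>insert x \<tau>\<close> is a circuit (\<open>blocked_le_spanned\<close>). Such an \<open>x\<close> lies in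
  the closure of \<open>\<sigma>\<close> and determines \<open>\<tau>\<close>, so enough unit vectors stay free (\<open>triple_fibre\<close>).
\<close>

section \<open>Independence, rank and circuits\<close>

context matroid
begin

lemma indep_finite: "indep M I \<Longrightarrow> finite I"
  using finite_ground finite_subset indep_subset_ground by blast

lemma finite_indeps: "finite {I. I \<subseteq> X \<and> indep M I}"
  by (rule finite_subset[of _ "Pow (ground M)"]) (auto dest: indep_subset_ground simp: finite_ground)

lemma card_le_rank: "indep M I \<Longrightarrow> I \<subseteq> X \<Longrightarrow> card I \<le> rank_of M X"
  unfolding rank_of_def by (rule Max_ge) (auto simp: finite_indeps)

lemma rank_attained: obtains I where "I \<subseteq> X" "indep M I" "card I = rank_of M X"
proof -
  have "rank_of M X \<in> card ` {I. I \<subseteq> X \<and> indep M I}"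
    unfolding rank_of_def by (rule Max_in) (use finite_indeps indep_empty in auto)
  then show ?thesis using that by auto
qed

lemma rank_le_card: "finite X \<Longrightarrow> rank_of M X \<le> card X"
  by (metis card_mono rank_attained)

lemma rank_mono: "X \<subseteq> Y \<Longrightarrow> rank_of M X \<le> rank_of M Y"
  by (metis card_le_rank dual_order.trans rank_attained)

lemma rank_indep: "indep M I \<Longrightarrow> rank_of M I = card I"
  by (meson card_le_rank indep_finite le_antisym order_refl rank_le_card)

lemma extend_to_rank:
  assumes "indep M J" "J \<subseteq> X"
  obtains I where "J \<subseteq> I" "I \<subseteq> X" "indep M I" "card I = rank_of M X"
proof -
  obtain K where K: "K \<subseteq> X" "indep M K" "card K = rank_of M X" by (rule rank_attained)
  have "\<exists>I. J \<subseteq> I \<and> I \<subseteq> X \<and> indep M I \<and> card I = rank_of M X"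
    using assms
  proof (induction "rank_of M X - card J" arbitrary: J)
    case 0
    then have "card J = rank_of M X" using card_le_rank[OF 0(2,3)] by simp
    then show ?case using 0(2,3) by (intro exI[of _ J]) simp
  next
    case (Suc n)
    have "card J < card K" using Suc(2) K(3) by linarith
    then obtain e where e: "e \<in> K - J" "indep M (insert e J)"
      using augment[OF Suc(3) K(2)] by blast
    have n: "n = rank_of M X - card (insert e J)"
      using Suc(2) e indep_finite[OF Suc(3)] by simp
    have "insert e J \<subseteq> X" using Suc(4) e K by blast
    from Suc(1)[OF n e(2) this] obtain I where
      "insert e J \<subseteq> I \<and> I \<subseteq> X \<and> indep M I \<and> card I = rank_of M X" ..
    then show ?case by (intro exI[of _ I]) simp
  qed
  then show ?thesis using that by blast
qed

lemma rank_insert_le: "rank_of M (insert x X) \<le> Suc (rank_of M X)"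
proof -
  obtain I where I: "I \<subseteq> insert x X" "indep M I" "card I = rank_of M (insert x X)"
    by (rule rank_attained)
  have "card (I - {x}) \<le> rank_of M X"
    using I by (intro card_le_rank indep_mono[OF I(2)]) auto
  then show ?thesis using I(3) card_Diff1_le[of I x] card_Suc_Diff1[of I x] indep_finite[OF I(2)]
    by (cases "x \<in> I") auto
qed

text \<open>An element in the closure of \<open>U\<close>, here in the form of a dependent extension of an
  independent \<open>U\<close>, adds nothing to the rank of a set containing \<open>U\<close>.\<close>

lemma rank_insert_spanned:
  assumes "indep M U" "\<not> indep M (insert x U)" "U \<subseteq> Z"
  shows "rank_of M (insert x Z) = rank_of M Z"
proof (rule antisym[OF _ rank_mono])
  obtain I where I: "U \<subseteq> I" "I \<subseteq> Z" "indep M I" "card I = rank_of M Z"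
    using extend_to_rank[OF assms(1,3)] .
  show "rank_of M (insert x Z) \<le> rank_of M Z"
  proof (rule ccontr)
    assume "\<not> ?thesis"
    then have less: "card I < rank_of M (insert x Z)" using I by simp
    obtain K where K: "K \<subseteq> insert x Z" "indep M K" "card K = rank_of M (insert x Z)"
      by (rule rank_attained)
    obtain e where e: "e \<in> K - I" "indep M (insert e I)" using augment[OF I(3) K(2)] less K by auto
    have "e \<noteq> x" using e(2) assms(2) I(1) indep_mono by (metis insert_mono)
    then have "card (insert e I) \<le> rank_of M Z" using e K I by (intro card_le_rank) auto
    then show False using I e indep_finite[OF I(3)] by simp
  qed
qed auto

lemma dependent_contains_circuit:
  assumes "X \<subseteq> ground M" "\<not> indep M X"
  obtains C where "circuit M C" "C \<subseteq> X"
proof -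
  have "finite X" using assms finite_ground finite_subset by blast
  then have "\<exists>C. circuit M C \<and> C \<subseteq> X" using assms
  proof (induction X rule: finite_psubset_induct)
    case (psubset X)
    show ?case
    proof (cases "\<exists>D. D \<subset> X \<and> \<not> indep M D")
      case True
      then obtain D where D: "D \<subset> X" "\<not> indep M D" by blast
      then show ?thesis using psubset(2)[OF D(1)] psubset(3) by blast
    next
      case False
      then show ?thesis using psubset unfolding circuit_def by blast
    qed
  qed
  then show ?thesis using that by blast
qed

lemma circuit_finite: "circuit M C \<Longrightarrow> finite C"
  unfolding circuit_def using finite_ground finite_subset by blast

lemma circuit_proper_subset_indep: "circuit M C \<Longrightarrow> D \<subseteq> C \<Longrightarrow> D \<noteq> C \<Longrightarrow> indep M D"
  unfolding circuit_def by blast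

lemma circuit_not_subset_indep: "circuit M C \<Longrightarrow> indep M I \<Longrightarrow> \<not> C \<subseteq> I"
  using indep_mono[of I C] by (auto simp: circuit_def)

lemma circuit_insert_mem: "circuit M C \<Longrightarrow> indep M I \<Longrightarrow> C \<subseteq> insert e I \<Longrightarrow> e \<in> C"
  using circuit_not_subset_indep[of C I] by blast

text \<open>This is the uniqueness of fundamental circuits. If \<open>f\<close> were in \<open>C\<close> but not in \<open>D\<close>,
  augmenting the independent set \<open>C - {f}\<close> inside \<open>insert e I\<close> up to full rank would have to
  leave out exactly \<open>f\<close>, and the result would contain \<open>D\<close>.\<close>

lemma circuit_unique:
  assumes I: "indep M I" and C: "circuit M C" "C \<subseteq> insert e I" and D: "circuit M D" "D \<subseteq> insert e I"
  shows "C = D"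
proof -
  have sub: "C \<subseteq> D" if C: "circuit M C" "C \<subseteq> insert e I" and D: "circuit M D" "D \<subseteq> insert e I"
    for C D
  proof (rule ccontr)
    assume "\<not> C \<subseteq> D"
    then obtain f where f: "f \<in> C" "f \<notin> D" by blast
    have "e \<in> D" using circuit_insert_mem[OF D(1) I D(2)] .
    then have fI: "f \<in> I" "f \<noteq> e" using f C by auto
    have eI: "e \<notin> I" using circuit_not_subset_indep[OF D(1) I] D(2) by auto
    have CI: "indep M (C - {f})" using f by (intro circuit_proper_subset_indep[OF C(1)]) auto
    \<comment> \<open>Exchanging \<open>f\<close> for \<open>e\<close> in \<open>I\<close> gives an independent set, which then contains \<open>D\<close>.\<close>
    obtain J where J: "C - {f} \<subseteq> J" "J \<subseteq> insert e I" "indep M J" "card J = rank_of M (insert e I)"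
      using extend_to_rank[OF CI, of "insert e I"] C(2) by blast
    have "f \<notin> J" using J(1) circuit_not_subset_indep[OF C(1) J(3)] by auto
    moreover have "card J \<ge> card I" using J(4) card_le_rank[OF I, of "insert e I"] by auto
    moreover have "card (insert e I - {f}) = card I"
      using fI eI indep_finite[OF I] by (simp add: card_Diff_singleton)
    ultimately have "J = insert e I - {f}"
      using J(2) indep_finite[OF I] by (intro card_seteq) auto
    then have "D \<subseteq> J" using D f by blast
    then show False using circuit_not_subset_indep[OF D(1) J(3)] by blast
  qed
  show ?thesis using sub[OF C D] sub[OF D C] by blast
qed

lemma rank_remove_circuit_element:
  assumes "circuit M C" "C \<subseteq> X" "x \<in> C"
  shows "rank_of M (X - {x}) = rank_of M X"
proof -
  have "indep M (C - {x})" "insert x (C - {x}) = C"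
    using assms unfolding circuit_def by auto
  then have "rank_of M (insert x (X - {x})) = rank_of M (X - {x})"
    using assms by (intro rank_insert_spanned[of "C - {x}"]) (auto simp: circuit_def)
  then show ?thesis using assms by (simp add: insert_absorb subset_iff)
qed

end


section \<open>The h-polynomial of a minor\<close>

text \<open>If \<open>U\<close> is independent this is \<open>t\<close> to the power \<open>|U|\<close> times the h-polynomial of \<open>(M|A)/U\<close>,
  in the form \<open>\<Sum>I. t ^ |I| * (1 - t) ^ (r - |I|)\<close> over independent sets. Summing over the
  independent sets of \<open>M\<close> between \<open>U\<close> and \<open>A\<close> avoids forming the minor as a matroid; for
  dependent \<open>U\<close> the sum is empty, which is what makes the recursion below hold without case
  distinctions.\<close>

definition minor_poly :: "'a matroid_data \<Rightarrow> 'a set \<Rightarrow> 'a set \<Rightarrow> int poly" where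
  "minor_poly M U A = (\<Sum>I\<in>{I. indep M I \<and> U \<subseteq> I \<and> I \<subseteq> A}.
     monom 1 (card I) * [:1, -1:] ^ (rank_of M A - card I))"

lemma coeff_linear_power_above: "n < k \<Longrightarrow> coeff ([:a, b:] ^ n :: int poly) k = 0"
  by (intro coeff_eq_0 order_le_less_trans[OF degree_power_le]) auto

text \<open>Reversing the coefficients of \<open>(x - 1) ^ (d - i)\<close>, as a polynomial of degree \<open>d\<close>, gives
  \<open>t ^ i * (1 - t) ^ (d - i)\<close>: this is the passage from the Tutte polynomial to the
  h-polynomial.\<close>

lemma coeff_h_term:
  assumes "i \<le> d" "k \<le> d"
  shows "coeff ([:-1, 1:] ^ (d - i) :: int poly) (d - k) = coeff (monom 1 i * [:1, -1:] ^ (d - i)) k"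
proof (cases "i \<le> k")
  case True
  have "(d - i) choose (d - k) = (d - i) choose (k - i)"
    using binomial_symmetric[of "k - i" "d - i"] True assms by simp
  moreover have "d - i - (d - k) = k - i" using True assms by simp
  ultimately show ?thesis using True assms by (simp add: coeff_monom_mult coeff_linear_poly_power)
next
  case False
  then show ?thesis using assms by (simp add: coeff_monom_mult coeff_linear_power_above)
qed

text \<open>At \<open>y = 1\<close> the factor \<open>(y - 1)\<close> kills every term of the Tutte polynomial whose set has
  positive nullity, so that only independent sets contribute. The formula is for general set
  systems \<open>N\<close>, so that it applies directly to a contraction.\<close>

lemma h_vector_indep_sum:
  assumes fin: "finite (ground N)" and emp: "indep N {}"
  shows "h_vector N k = (if k \<le> rank N then
     (\<Sum>I\<in>{I. indep N I \<and> I \<subseteq> ground N}. coeff ([:-1, 1:] ^ (rank N - card I)) (rank N - k)) else 0)"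
proof -
  have rk: "card X - rank_of N X = 0 \<longleftrightarrow> indep N X" if X: "X \<subseteq> ground N" for X
  proof -
    have finX: "finite X" using X fin finite_subset by blast
    have fins: "finite (card ` {I. I \<subseteq> X \<and> indep N I})" using finX by simp
    show ?thesis
    proof
      assume "card X - rank_of N X = 0"
      moreover have "rank_of N X \<in> card ` {I. I \<subseteq> X \<and> indep N I}"
        unfolding rank_of_def by (rule Max_in[OF fins]) (use emp in auto)
      ultimately obtain I where "I \<subseteq> X" "indep N I" "card X \<le> card I" by auto
      then show "indep N X" using finX card_seteq by metis
    next
      assume "indep N X"
      then have "card X \<le> rank_of N X" unfolding rank_of_def by (intro Max_ge[OF fins]) auto
      then show "card X - rank_of N X = 0" by simp
    qed
  qed
  have rk': "rank_of N X = card X" if "X \<subseteq> ground N" "indep N X" for X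
  proof -
    have finX: "finite X" using that fin finite_subset by blast
    have "rank_of N X \<le> card X" unfolding rank_of_def
      by (rule Max.boundedI) (use finX emp card_mono in auto)
    then show ?thesis using rk that by force
  qed
  have "poly (tutte N) 1 = (\<Sum>X\<in>Pow (ground N).
     if indep N X then [:-1, 1:] ^ (rank N - card X) else 0)"
    unfolding tutte_def poly_sum
  proof (intro sum.cong refl)
    fix X assume "X \<in> Pow (ground N)"
    then show "poly ([:[:- 1, 1:]:] ^ (rank N - rank_of N X) * [:- 1, 1:] ^ (card X - rank_of N X)) 1
        = (if indep N X then [:-1, 1:] ^ (rank N - card X) else 0)"
      using rk[of X] rk'[of X] by (auto simp: power_0_left)
  qed
  also have "\<dots> = (\<Sum>I\<in>{I. indep N I \<and> I \<subseteq> ground N}. [:-1, 1:] ^ (rank N - card I))"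
    by (simp add: sum.If_cases fin Int_def conj_commute)
  finally show ?thesis unfolding h_vector_def by (simp add: coeff_sum)
qed

context matroid
begin

lemma finite_between: "finite {I. indep M I \<and> U \<subseteq> I \<and> I \<subseteq> A}"
  by (rule finite_subset[OF _ finite_indeps[of A]]) auto

lemma coeff_minor_poly_above_rank: "rank_of M A < k \<Longrightarrow> coeff (minor_poly M U A) k = 0"
proof -
  assume k: "rank_of M A < k"
  have "coeff (monom 1 (card I) * [:1, -1:] ^ (rank_of M A - card I) :: int poly) k = 0"
    if "indep M I" "I \<subseteq> A" for I
    using card_le_rank[OF that] k by (auto simp: coeff_monom_mult intro: coeff_linear_power_above)
  then show ?thesis unfolding minor_poly_def by (simp add: coeff_sum sum.neutral)
qed

lemma h_vector_minor:
  assumes "U \<subseteq> A" "A \<subseteq> ground M" "indep M U"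
  shows "h_vector (contraction (restriction M A) U) k = coeff (minor_poly M U A) (card U + k)"
    and "rank (contraction (restriction M A) U) = rank_of M A - card U"
proof -
  let ?N = "contraction (restriction M A) U"
  have finA: "finite A" using assms finite_ground finite_subset by blast
  have bas: "basis_of (restriction M A) U B \<longleftrightarrow> B = U" for B
    using assms unfolding basis_of_def restriction_def by auto
  have gr: "ground ?N = A - U" by (simp add: contraction_def restriction_def)
  have ind: "indep ?N X \<longleftrightarrow> X \<subseteq> A - U \<and> indep M (X \<union> U)" for X
    unfolding contraction_def bas using assms by (auto simp: restriction_def)
  have bij: "bij_betw (\<lambda>I. I - U) {I. indep M I \<and> U \<subseteq> I \<and> I \<subseteq> A} {X. indep ?N X \<and> X \<subseteq> ground ?N}"
  proof (rule bij_betw_byWitness[where f' = "\<lambda>X. X \<union> U"])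
    show "(\<lambda>I. I - U) ` {I. indep M I \<and> U \<subseteq> I \<and> I \<subseteq> A} \<subseteq> {X. indep ?N X \<and> X \<subseteq> ground ?N}"
      unfolding ind gr using assms(1) by (auto simp: Un_absorb2)
    show "(\<lambda>X. X \<union> U) ` {X. indep ?N X \<and> X \<subseteq> ground ?N} \<subseteq> {I. indep M I \<and> U \<subseteq> I \<and> I \<subseteq> A}"
      unfolding ind gr using assms(1) by blast
    show "\<forall>X\<in>{X. indep ?N X \<and> X \<subseteq> ground ?N}. X \<union> U - U = X"
      unfolding gr by blast
  qed blast
  have card': "card (I - U) = card I - card U" "card U \<le> card I" "card I \<le> rank_of M A"
    if "indep M I" "U \<subseteq> I" "I \<subseteq> A" for I
    using that card_le_rank[of I A] indep_finite[of I] indep_finite[OF assms(3)]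
    by (auto simp: card_Diff_subset card_mono)
  have le: "card U \<le> rank_of M A" using card_le_rank assms by blast
  show rk: "rank ?N = rank_of M A - card U"
  proof (rule antisym)
    have "rank ?N = Max (card ` {X. indep ?N X \<and> X \<subseteq> ground ?N})"
      unfolding rank_of_def by (simp add: conj_commute)
    also have "{X. indep ?N X \<and> X \<subseteq> ground ?N} = (\<lambda>I. I - U) ` {I. indep M I \<and> U \<subseteq> I \<and> I \<subseteq> A}"
      using bij by (simp add: bij_betw_def)
    finally have eq: "rank ?N = Max ((\<lambda>I. card (I - U)) ` {I. indep M I \<and> U \<subseteq> I \<and> I \<subseteq> A})"
      by (simp add: image_image)
    show "rank ?N \<le> rank_of M A - card U"
      unfolding eq using finite_between assms card'
      by (intro Max.boundedI) (auto simp: diff_le_mono)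
    obtain I where I: "U \<subseteq> I" "I \<subseteq> A" "indep M I" "card I = rank_of M A"
      using extend_to_rank[OF assms(3,1)] .
    show "rank_of M A - card U \<le> rank ?N"
      unfolding eq using finite_between card'(1)[of I] I
      by (intro Max_ge) (auto intro!: image_eqI[of _ _ I])
  qed
  have "h_vector ?N k = (if k \<le> rank ?N then
     (\<Sum>X\<in>{X. indep ?N X \<and> X \<subseteq> ground ?N}. coeff ([:-1, 1:] ^ (rank ?N - card X)) (rank ?N - k)) else 0)"
    by (rule h_vector_indep_sum) (use finA assms in \<open>auto simp: gr ind\<close>)
  also have "(\<Sum>X\<in>{X. indep ?N X \<and> X \<subseteq> ground ?N}. coeff ([:-1, 1:] ^ (rank ?N - card X)) (rank ?N - k))
    = (\<Sum>I\<in>{I. indep M I \<and> U \<subseteq> I \<and> I \<subseteq> A}. coeff ([:-1, 1:] ^ (rank ?N - card (I - U))) (rank ?N - k) :: int)"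
    by (rule sum.reindex_bij_betw[OF bij, symmetric])
  finally have h: "h_vector ?N k = (if k \<le> rank ?N then
     (\<Sum>I\<in>{I. indep M I \<and> U \<subseteq> I \<and> I \<subseteq> A}. coeff ([:-1, 1:] ^ (rank ?N - card (I - U))) (rank ?N - k)) else 0)" .
  show "h_vector ?N k = coeff (minor_poly M U A) (card U + k)"
  proof (cases "k \<le> rank ?N")
    case True
    have "coeff ([:-1, 1:] ^ (rank ?N - card (I - U)) :: int poly) (rank ?N - k)
      = coeff (monom 1 (card I) * [:1, -1:] ^ (rank_of M A - card I)) (card U + k)"
      if I: "indep M I" "U \<subseteq> I" "I \<subseteq> A" for I
    proof -
      have e: "rank ?N - card (I - U) = rank_of M A - card I" "rank ?N - k = rank_of M A - (card U + k)"
        using card'[OF I] le True by (auto simp: rk)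
      show ?thesis unfolding e using card'[OF I] le True rk by (intro coeff_h_term) auto
    qed
    then show ?thesis using True h by (simp add: minor_poly_def coeff_sum)
  next
    case False
    then show ?thesis using h coeff_minor_poly_above_rank[of A "card U + k" U] rk by simp
  qed
qed

lemma h_vector_eq: "h_vector M k = coeff (minor_poly M {} (ground M)) k"
proof (cases "k \<le> rank M")
  case True
  then have "coeff ([:-1, 1:] ^ (rank M - card I) :: int poly) (rank M - k)
      = coeff (monom 1 (card I) * [:1, -1:] ^ (rank M - card I)) k"
    if "indep M I" "I \<subseteq> ground M" for I
    using card_le_rank[OF that] by (intro coeff_h_term) auto
  then show ?thesis using True
    by (simp add: h_vector_indep_sum[OF finite_ground indep_empty] minor_poly_def coeff_sum)
next
  case False
  then show ?thesis using coeff_minor_poly_above_rank by (simp add: h_vector_def)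
qed

lemma minor_poly_dependent: "\<not> indep M U \<Longrightarrow> minor_poly M U A = 0"
proof -
  assume "\<not> indep M U"
  then have "{I. indep M I \<and> U \<subseteq> I \<and> I \<subseteq> A} = {}" by (auto dest: indep_mono)
  then show ?thesis unfolding minor_poly_def by (simp only: sum.empty)
qed

lemma minor_poly_self: "indep M U \<Longrightarrow> minor_poly M U U = monom 1 (card U)"
proof -
  assume "indep M U"
  then have "{I. indep M I \<and> U \<subseteq> I \<and> I \<subseteq> U} = {U}" by auto
  then show ?thesis using \<open>indep M U\<close> by (simp add: minor_poly_def rank_indep)
qed

lemma minor_poly_delete_contract:
  assumes "rank_of M (A - {e}) = rank_of M A" "e \<notin> U" "e \<in> A"
  shows "minor_poly M U A = minor_poly M U (A - {e}) + minor_poly M (insert e U) A"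
proof -
  have split: "{I. indep M I \<and> U \<subseteq> I \<and> I \<subseteq> A} =
      {I. indep M I \<and> U \<subseteq> I \<and> I \<subseteq> A - {e}} \<union> {I. indep M I \<and> insert e U \<subseteq> I \<and> I \<subseteq> A}"
    using assms by auto
  show ?thesis unfolding minor_poly_def split assms(1)
    by (rule sum.union_disjoint[OF finite_between finite_between]) auto
qed

text \<open>The element \<open>e\<close> is a coloop of \<open>M|insert e X\<close>: independent sets of \<open>X\<close> stay independent
  when \<open>e\<close> is added. Those avoiding \<open>e\<close> contribute \<open>(1 - t)\<close> times the polynomial of \<open>X\<close>, those
  containing it \<open>t\<close> times, together exactly the polynomial of \<open>X\<close>.\<close>

lemma minor_poly_coloop:
  assumes r: "rank_of M (insert e X) = Suc (rank_of M X)" and V: "V \<subseteq> X"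
  shows "minor_poly M V (insert e X) = minor_poly M V X"
    and "minor_poly M (insert e V) (insert e X) = monom 1 1 * minor_poly M V X"
proof -
  have eX: "e \<notin> X" using r by (metis insert_absorb n_not_Suc_n)
  have ind: "indep M (insert e J)" if "indep M J" "J \<subseteq> X" for J
    using rank_insert_spanned[of J e X] that r by auto
  have bij: "bij_betw (insert e) {I. indep M I \<and> V \<subseteq> I \<and> I \<subseteq> X}
      {I. indep M I \<and> insert e V \<subseteq> I \<and> I \<subseteq> insert e X}"
  proof (rule bij_betw_byWitness[where f' = "\<lambda>I. I - {e}"])
    show "\<forall>I\<in>{I. indep M I \<and> V \<subseteq> I \<and> I \<subseteq> X}. insert e I - {e} = I"
      using eX by blast
    show "insert e ` {I. indep M I \<and> V \<subseteq> I \<and> I \<subseteq> X} \<subseteq>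
        {I. indep M I \<and> insert e V \<subseteq> I \<and> I \<subseteq> insert e X}"
      using ind by blast
    show "(\<lambda>I. I - {e}) ` {I. indep M I \<and> insert e V \<subseteq> I \<and> I \<subseteq> insert e X} \<subseteq>
        {I. indep M I \<and> V \<subseteq> I \<and> I \<subseteq> X}"
    proof clarify
      fix I assume I: "indep M I" "insert e V \<subseteq> I" "I \<subseteq> insert e X"
      have "indep M (I - {e})" by (rule indep_mono[OF I(1) Diff_subset])
      moreover have "V \<subseteq> I - {e}" using I(2) eX V by (auto simp: subset_iff)
      moreover have "I - {e} \<subseteq> X" using I(3) by auto
      ultimately show "indep M (I - {e}) \<and> V \<subseteq> I - {e} \<and> I - {e} \<subseteq> X" by simp
    qed
  qed (simp add: insert_absorb)
  have card_e: "card (insert e I) = Suc (card I)" if "indep M I" "I \<subseteq> X" for I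
    using indep_finite[OF that(1)] that(2) eX by (intro card_insert_disjoint) auto
  let ?t = "monom 1 1 :: int poly"
  have "minor_poly M (insert e V) (insert e X) = (\<Sum>I\<in>{I. indep M I \<and> V \<subseteq> I \<and> I \<subseteq> X}.
      monom 1 (card (insert e I)) * [:1, -1:] ^ (Suc (rank_of M X) - card (insert e I)))"
    unfolding minor_poly_def r by (rule sum.reindex_bij_betw[OF bij, symmetric])
  also have "\<dots> = ?t * minor_poly M V X"
    unfolding minor_poly_def sum_distrib_left
    by (intro sum.cong refl) (simp add: card_e mult_monom mult.assoc[symmetric])
  finally show contracted: "minor_poly M (insert e V) (insert e X) = ?t * minor_poly M V X" .
  have split: "{I. indep M I \<and> V \<subseteq> I \<and> I \<subseteq> insert e X} =
      {I. indep M I \<and> V \<subseteq> I \<and> I \<subseteq> X} \<union> {I. indep M I \<and> insert e V \<subseteq> I \<and> I \<subseteq> insert e X}"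
    by auto
  have "minor_poly M V (insert e X) = (\<Sum>I\<in>{I. indep M I \<and> V \<subseteq> I \<and> I \<subseteq> X}.
      monom 1 (card I) * [:1, -1:] ^ (Suc (rank_of M X) - card I)) + minor_poly M (insert e V) (insert e X)"
    unfolding minor_poly_def split r
    by (rule sum.union_disjoint[OF finite_between finite_between]) (use eX in auto)
  also have "(\<Sum>I\<in>{I. indep M I \<and> V \<subseteq> I \<and> I \<subseteq> X}.
      monom 1 (card I) * [:1, -1:] ^ (Suc (rank_of M X) - card I)) = [:1, -1:] * minor_poly M V X"
    unfolding minor_poly_def sum_distrib_left
    by (intro sum.cong refl) (auto simp: Suc_diff_le card_le_rank algebra_simps)
  also have "[:1, -1:] * minor_poly M V X + minor_poly M (insert e V) (insert e X)
      = ([:1, -1:] + ?t) * minor_poly M V X"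
    unfolding contracted by (simp only: distrib_right)
  also have "[:1, -1:] + ?t = 1" by (simp add: monom_altdef)
  finally show "minor_poly M V (insert e X) = minor_poly M V X" by simp
qed

lemma minor_poly_coloops:
  assumes "finite D" "rank_of M (X \<union> D) = rank_of M X + card D" "V \<subseteq> X" "L \<subseteq> D"
  shows "minor_poly M (V \<union> L) (X \<union> D) = monom 1 (card L) * minor_poly M V X"
  using assms
proof (induction D arbitrary: L)
  case empty
  then show ?case by simp
next
  case (insert e D)
  have le: "rank_of M (X \<union> D) \<le> rank_of M X + card D"
    using \<open>finite D\<close>
  proof induction
    case (insert f D)
    then show ?case using rank_insert_le[of f "X \<union> D"] by simp
  qed simp
  have up: "rank_of M (insert e (X \<union> D)) = Suc (rank_of M (X \<union> D))"
    using rank_insert_le[of e "X \<union> D"] le insert by simp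
  have r: "rank_of M (X \<union> D) = rank_of M X + card D" using up insert by simp
  have fL: "finite L" using insert finite_subset by blast
  have IH: "minor_poly M (V \<union> (L - {e})) (X \<union> D) = monom 1 (card (L - {e})) * minor_poly M V X"
    using insert.prems by (intro insert.IH r) auto
  show ?case
  proof (cases "e \<in> L")
    case True
    have "minor_poly M (insert e (V \<union> (L - {e}))) (insert e (X \<union> D))
        = monom 1 1 * minor_poly M (V \<union> (L - {e})) (X \<union> D)"
      using insert.prems by (intro minor_poly_coloop(2) up) auto
    moreover have "insert e (V \<union> (L - {e})) = V \<union> L" using True by blast
    ultimately show ?thesis
      unfolding card.remove[OF fL True] IH by (simp add: mult_monom mult.assoc[symmetric])
  next
    case False
    have "minor_poly M (V \<union> L) (insert e (X \<union> D)) = minor_poly M (V \<union> L) (X \<union> D)"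
      using insert.prems False by (intro minor_poly_coloop(1) up) auto
    then show ?thesis using False IH by simp
  qed
qed

lemma coeff_minor_poly_nonneg:
  assumes "finite A" "U \<subseteq> A"
  shows "0 \<le> coeff (minor_poly M U A) k"
  using assms
proof (induction "card (A - U)" arbitrary: U A)
  case 0
  then have "U = A" by simp
  then show ?case by (cases "indep M U") (simp_all add: minor_poly_self minor_poly_dependent)
next
  case (Suc n)
  then have "A - U \<noteq> {}" by (metis card.empty nat.distinct(1))
  then obtain e where e: "e \<in> A" "e \<notin> U" by blast
  have Ae: "insert e (A - {e}) = A" using e by blast
  have "A - {e} - U = A - U - {e}" "A - insert e U = A - U - {e}" by auto
  then have n: "n = card (A - {e} - U)" "n = card (A - insert e U)" using Suc(2,3) e by simp_all
  then have nn: "0 \<le> coeff (minor_poly M U (A - {e})) k" "0 \<le> coeff (minor_poly M (insert e U) A) k"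
    using Suc e by (auto intro!: Suc(1))
  show ?case
  proof (cases "rank_of M (A - {e}) = rank_of M A")
    case True
    then show ?thesis using nn minor_poly_delete_contract[OF True e(2,1)] by simp
  next
    case False
    then have "rank_of M A = Suc (rank_of M (A - {e}))"
      using rank_insert_le[of e "A - {e}", unfolded Ae] rank_mono[of "A - {e}" A] by auto
    then have "minor_poly M U A = minor_poly M U (A - {e})"
      using minor_poly_coloop(1)[of e "A - {e}" U, unfolded Ae] Suc(4) e by auto
    then show ?thesis using nn by simp
  qed
qed

text \<open>The last entry of the h-vector of a matroid without coloops is positive: contract an
  element that is not a loop, which creates no coloop while the deletion contributes
  nonnegatively, or delete a loop.\<close>

lemma top_coeff_minor_poly_pos:
  assumes "finite A" "U \<subseteq> A" "indep M U" "\<And>x. x \<in> A - U \<Longrightarrow> rank_of M (A - {x}) = rank_of M A"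
  shows "0 < coeff (minor_poly M U A) (rank_of M A)"
  using assms
proof (induction "card (A - U)" arbitrary: U A)
  case 0
  then have "U = A" by simp
  then show ?case using 0 by (simp add: minor_poly_self rank_indep)
next
  case (Suc n)
  then have "A - U \<noteq> {}" by (metis card.empty nat.distinct(1))
  then obtain e where e: "e \<in> A" "e \<notin> U" by blast
  have "A - {e} - U = A - U - {e}" "A - insert e U = A - U - {e}" by auto
  then have n: "n = card (A - {e} - U)" "n = card (A - insert e U)" using Suc(2,3) e by simp_all
  have r: "rank_of M (A - {e}) = rank_of M A" using Suc e by simp
  have dc: "minor_poly M U A = minor_poly M U (A - {e}) + minor_poly M (insert e U) A"
    by (rule minor_poly_delete_contract[OF r e(2,1)])
  show ?case
  proof (cases "indep M (insert e U)")
    case True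
    have "0 < coeff (minor_poly M (insert e U) A) (rank_of M A)"
      using Suc True e n by (intro Suc(1)) auto
    then show ?thesis using coeff_minor_poly_nonneg[of "A - {e}" U] Suc e by (simp add: dc add_nonneg_pos subset_Diff_insert)
  next
    case False
    have "0 < coeff (minor_poly M U (A - {e})) (rank_of M (A - {e}))"
    proof (intro Suc(1) n)
      fix x assume x: "x \<in> A - {e} - U"
      have "rank_of M (insert e (A - {e} - {x})) = rank_of M (A - {e} - {x})"
        using Suc e x by (intro rank_insert_spanned[OF _ False]) auto
      moreover have "insert e (A - {e} - {x}) = A - {x}" using e x by auto
      ultimately show "rank_of M (A - {e} - {x}) = rank_of M (A - {e})" using r Suc(6)[of x] x by simp
    qed (use Suc e in auto)
    then show ?thesis using minor_poly_dependent[OF False] by (simp add: dc r)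
  qed
qed

end


section \<open>Strata\<close>

text \<open>Throughout, \<open>C i\<close> is the fundamental circuit of \<open>i\<close>; \<open>U \<sigma>\<close> and \<open>A \<sigma>\<close> collect the elements
  on exactly one, respectively at least one, of the circuits \<open>C i\<close> with \<open>i \<in> \<sigma>\<close>; and \<open>b \<sigma>\<close> is
  the baseline.\<close>

locale matroid_with_basis = matroid M for M :: "'a matroid_data" +
  fixes B0 :: "'a set"
  assumes basis_B0: "basis M B0"
begin

abbreviation R where "R \<equiv> ground M - B0"
abbreviation C where "C \<equiv> fundamental_circuit M B0"
abbreviation U where "U \<equiv> U_set M B0"
abbreviation A where "A \<equiv> A_set M B0"
abbreviation b where "b \<equiv> baseline M B0"

lemma B0_indep: "indep M B0" and B0_subset: "B0 \<subseteq> ground M"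
  using basis_B0 by (auto simp: basis_of_def)

lemma finite_R: "finite R"
  using finite_ground by simp

lemma finite_B0: "finite B0"
  using B0_indep indep_finite by blast

lemma card_B0: "card B0 = rank M"
proof -
  obtain I where I: "B0 \<subseteq> I" "I \<subseteq> ground M" "indep M I" "card I = rank M"
    using extend_to_rank[OF B0_indep B0_subset] .
  then have "I = B0" using basis_B0 by (simp add: basis_of_def)
  then show ?thesis using I by simp
qed

lemma fundamental_circuit_props:
  assumes "i \<in> R"
  shows "circuit M (C i)" "C i \<subseteq> insert i B0"
proof -
  have "\<not> indep M (insert i B0)"
    using basis_B0 assms B0_subset unfolding basis_of_def by blast
  then obtain D where D: "circuit M D" "D \<subseteq> insert i B0"
    using dependent_contains_circuit[of "insert i B0"] assms B0_subset by blast
  have "circuit M (C i) \<and> C i \<subseteq> insert i B0"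
    unfolding fundamental_circuit_def
    by (rule theI[of _ D]) (use D circuit_unique[OF B0_indep] in blast)+
  then show "circuit M (C i)" "C i \<subseteq> insert i B0" by auto
qed

lemma fundamental_circuit_eqI: "i \<in> R \<Longrightarrow> circuit M D \<Longrightarrow> D \<subseteq> insert i B0 \<Longrightarrow> D = C i"
  using circuit_unique[OF B0_indep] fundamental_circuit_props by blast

lemma self_in_C: "i \<in> R \<Longrightarrow> i \<in> C i"
  using circuit_insert_mem[OF _ B0_indep] fundamental_circuit_props by blast

lemma in_C_R: "i \<in> R \<Longrightarrow> j \<in> R \<Longrightarrow> j \<in> C i \<Longrightarrow> j = i"
  using fundamental_circuit_props(2)[of i] by auto

lemma C_ground: "i \<in> R \<Longrightarrow> C i \<subseteq> ground M"
  using fundamental_circuit_props(1) by (auto simp: circuit_def)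

lemma finite_C: "i \<in> R \<Longrightarrow> finite (C i)"
  using fundamental_circuit_props(1) circuit_finite by blast

lemma stratum_iff: "stratum M B0 \<sigma> \<longleftrightarrow> \<sigma> \<noteq> {} \<and> \<sigma> \<subseteq> R"
  by (simp add: stratum_def)

lemma finite_stratum: "\<sigma> \<subseteq> R \<Longrightarrow> finite \<sigma>"
  using finite_R finite_subset by blast

lemma in_A_iff:
  assumes "\<sigma> \<subseteq> R" shows "e \<in> A \<sigma> \<longleftrightarrow> (\<exists>i\<in>\<sigma>. e \<in> C i)"
proof -
  have "multiplicity M B0 \<sigma> e \<ge> 1 \<longleftrightarrow> {i \<in> \<sigma>. e \<in> C i} \<noteq> {}"
    unfolding multiplicity_def using finite_stratum[OF assms] by (simp add: Suc_le_eq card_gt_0_iff)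
  then show ?thesis unfolding A_set_def using C_ground assms by auto
qed

lemma in_U_iff:
  assumes "\<sigma> \<subseteq> R" shows "e \<in> U \<sigma> \<longleftrightarrow> (\<exists>i\<in>\<sigma>. e \<in> C i \<and> (\<forall>j\<in>\<sigma>. e \<in> C j \<longrightarrow> j = i))"
proof -
  have "multiplicity M B0 \<sigma> e = 1 \<longleftrightarrow> (\<exists>i. {i \<in> \<sigma>. e \<in> C i} = {i})"
    unfolding multiplicity_def by (simp add: card_1_singleton_iff)
  also have "\<dots> \<longleftrightarrow> (\<exists>i\<in>\<sigma>. e \<in> C i \<and> (\<forall>j\<in>\<sigma>. e \<in> C j \<longrightarrow> j = i))"
  proof
    assume "\<exists>i. {i \<in> \<sigma>. e \<in> C i} = {i}"
    then obtain i where i: "{i \<in> \<sigma>. e \<in> C i} = {i}" ..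
    have "i \<in> {i \<in> \<sigma>. e \<in> C i}" unfolding i by simp
    moreover have "j = i" if "j \<in> \<sigma>" "e \<in> C j" for j
      using that i by blast
    ultimately show "\<exists>i\<in>\<sigma>. e \<in> C i \<and> (\<forall>j\<in>\<sigma>. e \<in> C j \<longrightarrow> j = i)" by blast
  next
    assume "\<exists>i\<in>\<sigma>. e \<in> C i \<and> (\<forall>j\<in>\<sigma>. e \<in> C j \<longrightarrow> j = i)"
    then show "\<exists>i. {i \<in> \<sigma>. e \<in> C i} = {i}" by blast
  qed
  finally show ?thesis unfolding U_set_def using C_ground assms by blast
qed

lemma U_subset_A: "\<sigma> \<subseteq> R \<Longrightarrow> U \<sigma> \<subseteq> A \<sigma>"
  by (rule subsetI) (metis in_A_iff in_U_iff)

lemma A_ground: "A \<sigma> \<subseteq> ground M"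
  by (auto simp: A_set_def)

lemma finite_A: "finite (A \<sigma>)"
  using A_ground finite_ground finite_subset by blast

lemma finite_U: "finite (U \<sigma>)"
  using finite_ground by (simp add: U_set_def)

lemma stratum_subset_U:
  assumes "\<sigma> \<subseteq> R" shows "\<sigma> \<subseteq> U \<sigma>"
proof
  fix i assume i: "i \<in> \<sigma>"
  then have "i \<in> C i" using self_in_C assms by blast
  moreover have "\<forall>j\<in>\<sigma>. i \<in> C j \<longrightarrow> j = i" using in_C_R[of _ i] assms i by auto
  ultimately show "i \<in> U \<sigma>" unfolding in_U_iff[OF assms] by (intro bexI[OF _ i] conjI)
qed

lemma A_minus_stratum:
  assumes "\<sigma> \<subseteq> R" shows "A \<sigma> - \<sigma> = A \<sigma> \<inter> B0"
proof -
  have "e \<in> B0" if e: "e \<in> A \<sigma>" "e \<notin> \<sigma>" for e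
  proof -
    obtain i where "i \<in> \<sigma>" "e \<in> C i" using e(1) unfolding in_A_iff[OF assms] by blast
    then show ?thesis using fundamental_circuit_props(2)[of i] assms that by auto
  qed
  then show ?thesis using assms by auto
qed

lemma A_mono: "\<tau> \<subseteq> \<sigma> \<Longrightarrow> \<sigma> \<subseteq> R \<Longrightarrow> A \<tau> \<subseteq> A \<sigma>"
  by (rule subsetI) (metis in_A_iff subset_iff)

lemma C_subset_A: "i \<in> \<sigma> \<Longrightarrow> \<sigma> \<subseteq> R \<Longrightarrow> C i \<subseteq> A \<sigma>"
  by (auto simp: in_A_iff)

lemma private_part:
  assumes "\<sigma> \<subseteq> R" "i \<in> \<sigma>"
  shows "C i \<inter> U \<sigma> = A \<sigma> - A (\<sigma> - {i})"
proof -
  have s: "\<sigma> - {i} \<subseteq> R" using assms by blast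
  show ?thesis unfolding set_eq_iff Int_iff Diff_iff in_A_iff[OF assms(1)] in_A_iff[OF s] in_U_iff[OF assms(1)]
    using assms(2) by blast
qed

lemma private_antimono: "i \<in> \<tau> \<Longrightarrow> \<tau> \<subseteq> \<sigma> \<Longrightarrow> \<sigma> \<subseteq> R \<Longrightarrow> C i \<inter> U \<sigma> \<subseteq> C i \<inter> U \<tau>"
proof clarify
  fix e assume *: "i \<in> \<tau>" "\<tau> \<subseteq> \<sigma>" "\<sigma> \<subseteq> R" "e \<in> C i" "e \<in> U \<sigma>"
  then have "\<tau> \<subseteq> R" by blast
  show "e \<in> U \<tau>"
    using * unfolding in_U_iff[OF \<open>\<sigma> \<subseteq> R\<close>] in_U_iff[OF \<open>\<tau> \<subseteq> R\<close>] by blast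
qed

lemma baseline_antimono: "i \<in> \<tau> \<Longrightarrow> \<tau> \<subseteq> \<sigma> \<Longrightarrow> \<sigma> \<subseteq> R \<Longrightarrow> b \<sigma> i \<le> b \<tau> i"
  unfolding baseline_def using private_antimono[of i \<tau> \<sigma>] finite_U by (auto intro!: card_mono)

lemma baseline_monomial: "b \<sigma> \<in> monomials \<sigma>"
  by (simp add: monomials_def baseline_def)

lemma U_eq_Union: "\<sigma> \<subseteq> R \<Longrightarrow> U \<sigma> = (\<Union>i\<in>\<sigma>. C i \<inter> U \<sigma>)"
  by (rule set_eqI) (metis (no_types, lifting) IntD2 IntI UN_iff in_U_iff)

lemma card_split:
  assumes "\<sigma> \<subseteq> R" "W \<subseteq> U \<sigma>"
  shows "(\<Sum>i\<in>\<sigma>. card (W \<inter> C i)) = card W"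
proof -
  have W: "W = (\<Union>i\<in>\<sigma>. W \<inter> C i)" using U_eq_Union[OF assms(1)] assms(2) by blast
  have disj: "C i \<inter> C j \<inter> U \<sigma> = {}" if "i \<in> \<sigma>" "j \<in> \<sigma>" "i \<noteq> j" for i j
  proof -
    have False if "e \<in> C i" "e \<in> C j" "e \<in> U \<sigma>" for e
      using that(3) \<open>i \<noteq> j\<close> \<open>i \<in> \<sigma>\<close> \<open>j \<in> \<sigma>\<close> that(1,2) unfolding in_U_iff[OF assms(1)] by blast
    then show ?thesis by blast
  qed
  have "card (\<Union>i\<in>\<sigma>. W \<inter> C i) = (\<Sum>i\<in>\<sigma>. card (W \<inter> C i))"
    using disj assms finite_subset[OF assms(2) finite_U] finite_stratum
    by (intro card_UN_disjoint) blast+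
  then show ?thesis using W by simp
qed

lemma sum_monomial: "a \<in> monomials \<sigma> \<Longrightarrow> \<sigma> \<subseteq> V \<Longrightarrow> finite V \<Longrightarrow> sum a V = sum a \<sigma>"
  by (rule sum.mono_neutral_right) (auto simp: monomials_def)

lemma sum_baseline: "\<sigma> \<subseteq> R \<Longrightarrow> sum (b \<sigma>) \<sigma> = card (U \<sigma>)"
  using card_split[of \<sigma> "U \<sigma>"] by (simp add: baseline_def Int_commute)

text \<open>The part of \<open>B0\<close> inside \<open>A \<sigma>\<close> spans \<open>A \<sigma>\<close>, because every other element of \<open>A \<sigma>\<close>
  closes one of the circuits of which \<open>A \<sigma>\<close> is the union.\<close>

lemma rank_A: "\<sigma> \<subseteq> R \<Longrightarrow> rank_of M (A \<sigma>) = card (A \<sigma> \<inter> B0)"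
proof (rule antisym)
  assume s: "\<sigma> \<subseteq> R"
  have ind: "indep M (A \<sigma> \<inter> B0)" using B0_indep indep_mono Int_lower2 by metis
  then show "card (A \<sigma> \<inter> B0) \<le> rank_of M (A \<sigma>)" by (rule card_le_rank) simp
  obtain I where I: "I \<subseteq> A \<sigma>" "indep M I" "card I = rank_of M (A \<sigma>)" by (rule rank_attained)
  show "rank_of M (A \<sigma>) \<le> card (A \<sigma> \<inter> B0)"
  proof (rule ccontr)
    assume "\<not> ?thesis"
    then have "card (A \<sigma> \<inter> B0) < card I" using I(3) by linarith
    then obtain e where e: "e \<in> I - A \<sigma> \<inter> B0" "indep M (insert e (A \<sigma> \<inter> B0))"
      using augment[OF ind I(2)] by blast
    have es: "e \<in> \<sigma>" using e(1) I(1) A_minus_stratum[OF s] by blast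
    then have "C e \<subseteq> insert e (A \<sigma> \<inter> B0)"
      using fundamental_circuit_props(2)[of e] C_subset_A[OF es s] s by blast
    moreover have "circuit M (C e)" using fundamental_circuit_props(1) es s by blast
    ultimately show False using circuit_not_subset_indep e(2) by blast
  qed
qed

lemma card_A: "\<sigma> \<subseteq> R \<Longrightarrow> card (A \<sigma>) = rank_of M (A \<sigma>) + card \<sigma>"
proof -
  assume s: "\<sigma> \<subseteq> R"
  have "\<sigma> \<subseteq> A \<sigma>" using s stratum_subset_U U_subset_A by blast
  then have "card (A \<sigma>) = card (A \<sigma> - \<sigma>) + card \<sigma>"
    using finite_A finite_stratum[OF s] by (metis card_Diff_subset card_mono le_add_diff_inverse2)
  then show ?thesis by (simp add: A_minus_stratum[OF s] rank_A[OF s])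
qed

text \<open>\<open>A \<sigma>\<close> is a union of circuits.\<close>

lemma no_coloop_in_A:
  assumes "\<sigma> \<subseteq> R" "x \<in> A \<sigma>"
  shows "rank_of M (A \<sigma> - {x}) = rank_of M (A \<sigma>)"
proof -
  obtain i where i: "i \<in> \<sigma>" "x \<in> C i" using assms(2) unfolding in_A_iff[OF assms(1)] by blast
  show ?thesis
    by (rule rank_remove_circuit_element[OF fundamental_circuit_props(1) C_subset_A[OF i(1) assms(1)] i(2)])
       (use i assms in blast)
qed

text \<open>This is deletion and contraction of an element \<open>e\<close> that lies on the single circuit \<open>C i\<close>.
  The rank of \<open>A \<sigma>\<close> survives the deletion, but the nullity drops by one, so the remaining
  elements covered by \<open>C i\<close> alone have become coloops over \<open>A (\<sigma> - {i})\<close>; those of them in \<open>W\<close>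
  contribute a factor \<open>t\<close> each.\<close>

lemma minor_poly_burn:
  assumes s: "\<sigma> \<subseteq> R" "i \<in> \<sigma>" and W: "W \<subseteq> U \<sigma>" and e: "e \<in> C i \<inter> U \<sigma>" "e \<notin> W"
  shows "minor_poly M W (A \<sigma>) =
    monom 1 (card (W \<inter> C i)) * minor_poly M (W - C i) (A (\<sigma> - {i})) + minor_poly M (insert e W) (A \<sigma>)"
proof -
  \<comment> \<open>After deletion of \<open>e\<close> the set \<open>A \<sigma>\<close> splits into \<open>?X\<close> and the coloops \<open>?D\<close>.\<close>
  let ?X = "A (\<sigma> - {i})" and ?D = "C i \<inter> U \<sigma> - {e}"
  have s': "\<sigma> - {i} \<subseteq> R" using s by blast
  have eA: "e \<in> A \<sigma>" using e U_subset_A[OF s(1)] by blast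
  note P = private_part[OF s]
  have XA: "?X \<subseteq> A \<sigma>" using A_mono[of "\<sigma> - {i}" \<sigma>] s by blast
  have XD: "?X \<union> ?D = A \<sigma> - {e}" using P XA e by blast
  have r: "rank_of M (A \<sigma> - {e}) = rank_of M (A \<sigma>)" by (rule no_coloop_in_A[OF s(1) eA])
  have "card ?D = card (A \<sigma> - ?X) - 1"
    using e P finite_A by (subst P[symmetric]) (simp add: card_Diff_singleton finite_U)
  also have "card (A \<sigma> - ?X) = card (A \<sigma>) - card ?X" using XA finite_A by (simp add: card_Diff_subset)
  finally have "card ?D = card (A \<sigma>) - card ?X - 1" .
  moreover have "card (A \<sigma>) > card ?X"
  proof (rule psubset_card_mono[OF finite_A])
    show "?X \<subset> A \<sigma>" using XA e P eA by blast
  qed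
  moreover have "card \<sigma> = Suc (card (\<sigma> - {i}))" using s finite_stratum[OF s(1)] by (metis card.remove)
  ultimately have rank: "rank_of M (?X \<union> ?D) = rank_of M ?X + card ?D"
    unfolding XD r using card_A[OF s(1)] card_A[OF s'] by linarith
  have "minor_poly M ((W - C i) \<union> (W \<inter> C i)) (?X \<union> ?D)
      = monom 1 (card (W \<inter> C i)) * minor_poly M (W - C i) ?X"
  proof (rule minor_poly_coloops[OF _ rank])
    show "W - C i \<subseteq> ?X" using W P U_subset_A[OF s(1)] by blast
    show "W \<inter> C i \<subseteq> ?D" using W e by blast
  qed (simp add: finite_U)
  moreover have "(W - C i) \<union> (W \<inter> C i) = W" by blast
  ultimately show ?thesis
    using minor_poly_delete_contract[OF r e(2) eA] by (simp add: XD)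
qed

lemma U_singleton: "i \<in> R \<Longrightarrow> U {i} = C i"
  by (rule set_eqI) (simp add: in_U_iff)

lemma dead_iff: "dead M B0 \<sigma> \<longleftrightarrow> \<sigma> \<noteq> {} \<and> \<sigma> \<subseteq> R \<and> indep M (U \<sigma>)"
  by (simp add: dead_def stratum_def)

lemma singleton_live: "\<not> dead M B0 {i}"
proof
  assume "dead M B0 {i}"
  then have "i \<in> R" "indep M (C i)" using U_singleton by (auto simp: dead_iff)
  then show False using circuit_not_subset_indep fundamental_circuit_props(1) by blast
qed

lemma baseline_singleton: "i \<in> R \<Longrightarrow> b {i} i = card (C i)"
  by (simp add: baseline_def U_singleton)

lemma
  assumes "dead M B0 \<sigma>"
  shows h_vector_dead_node: "h_vector (dead_node M B0 \<sigma>) k = coeff (minor_poly M (U \<sigma>) (A \<sigma>)) (card (U \<sigma>) + k)"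
    and rank_dead_node: "rank (dead_node M B0 \<sigma>) = rank_of M (A \<sigma>) - card (U \<sigma>)"
    and card_U_le_rank_A: "card (U \<sigma>) \<le> rank_of M (A \<sigma>)"
  unfolding dead_node_def
  using h_vector_minor[of "U \<sigma>" "A \<sigma>"] assms U_subset_A A_ground card_le_rank by (auto simp: dead_iff)

end


section \<open>Pure multicomplexes\<close>

definition generating_poly :: "'v set \<Rightarrow> ('v \<Rightarrow> nat) set \<Rightarrow> int poly" where
  "generating_poly V S = (\<Sum>a\<in>S. monom 1 (sum a V))"

lemma coeff_generating_poly: "finite S \<Longrightarrow> coeff (generating_poly V S) k = degree_sequence V S k"
  by (simp add: generating_poly_def degree_sequence_def coeff_sum sum.If_cases Int_def)

lemma monomials_eqI:
  assumes "a \<in> monomials V" "c \<in> monomials V" "finite V" "a \<le> c" "sum c V \<le> sum a V"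
  shows "a = c"
proof (rule ext, rule ccontr)
  fix i assume ne: "a i \<noteq> c i"
  then have i: "i \<in> V" using assms(1,2) by (cases "i \<in> V") (auto simp: monomials_def)
  have "a i < c i" using ne assms(4) by (simp add: le_fun_def order_less_le)
  then have "sum a V < sum c V"
    using assms(3,4) i by (intro sum_strict_mono_ex1) (auto simp: le_fun_def)
  then show False using assms(5) by simp
qed

lemma obtain_maximal_above:
  assumes S: "multicomplex V S" and V: "finite V" and m: "m \<in> S"
  obtains x where "maximal_monomial S x" "m \<le> x"
proof -
  have fin: "finite {x \<in> S. m \<le> x}" and sub: "S \<subseteq> monomials V"
    using S by (auto simp: multicomplex_def)
  obtain x where x: "x \<in> {x \<in> S. m \<le> x}" "\<And>y. y \<in> {x \<in> S. m \<le> x} \<Longrightarrow> sum y V \<le> sum x V"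
    using finite_has_maximal2[of "(\<lambda>x. sum x V) ` {x \<in> S. m \<le> x}" "sum m V"] fin m
    by (auto simp: not_le[symmetric]) (metis le_cases)
  have "y = x" if "y \<in> S" "x \<le> y" for y
  proof -
    have "y \<in> {x \<in> S. m \<le> x}" using that x(1) order_trans[of m x y] by simp
    then show ?thesis using monomials_eqI[of x V y] that x sub V by blast
  qed
  then show ?thesis using that[of x] x(1) by (auto simp: maximal_monomial_def)
qed

text \<open>In a pure multicomplex all maximal monomials have the largest degree that occurs, which
  can be read off from the degree sequence.\<close>

lemma pure_extend:
  assumes P: "pure_multicomplex V S" and V: "finite V"
    and top: "degree_sequence V S d \<noteq> 0" and bound: "\<And>k. d < k \<Longrightarrow> degree_sequence V S k = 0"
    and m: "m \<in> S"
  obtains x where "x \<in> S" "m \<le> x" "sum x V = d"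
proof -
  have S: "multicomplex V S" "finite S" "S \<subseteq> monomials V"
    using P by (auto simp: pure_multicomplex_def multicomplex_def)
  obtain c where c: "c \<in> S" "sum c V = d"
    using top by (auto simp: degree_sequence_def card_gt_0_iff)
  have le: "sum y V \<le> d" if "y \<in> S" for y
  proof (rule ccontr)
    assume "\<not> ?thesis"
    then have "card {a \<in> S. sum a V = sum y V} = 0" using bound[of "sum y V"] by (simp add: degree_sequence_def)
    then show False using that S(2) by auto
  qed
  have "maximal_monomial S c"
    unfolding maximal_monomial_def
  proof (intro conjI ballI impI c(1))
    fix y assume y: "y \<in> S" "c \<le> y"
    have "c = y" using c y le[OF y(1)] S(3) by (intro monomials_eqI[of c V y] V) auto
    then show "y = c" by simp
  qed
  moreover obtain x where x: "maximal_monomial S x" "m \<le> x" using obtain_maximal_above[OF S(1) V m] .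
  ultimately have "sum x V = sum c V" using P unfolding pure_multicomplex_def by meson
  moreover have "x \<in> S" using x(1) by (simp add: maximal_monomial_def)
  ultimately show ?thesis using that[OF _ x(2)] c(2) by simp
qed

lemma pure_multicomplexI:
  assumes "multicomplex V S" "\<And>a. a \<in> S \<Longrightarrow> \<exists>c\<in>S. a \<le> c \<and> sum c V = d"
  shows "pure_multicomplex V S"
  unfolding pure_multicomplex_def
proof (intro conjI allI impI assms(1))
  have "sum a V = d" if "maximal_monomial S a" for a
    using that assms(2)[of a] by (auto simp: maximal_monomial_def)
  then show "sum a V = sum b V" if "maximal_monomial S a \<and> maximal_monomial S b" for a b
    using that by simp
qed

text \<open>The variables may be taken from any finite set, by numbering them.\<close>

lemma pure_O_sequenceI:
  assumes V: "finite V" and S: "multicomplex V S"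
    and extends: "\<And>a. a \<in> S \<Longrightarrow> \<exists>c\<in>S. a \<le> c \<and> sum c V = d"
  shows "pure_O_sequence (degree_sequence V S)"
proof -
  obtain f where f: "bij_betw f {..<card V} V"
    using ex_bij_betw_nat_finite[OF V] by (auto simp: atLeast0LessThan)
  let ?n = "card V"
  define \<phi> where "\<phi> a = (\<lambda>k. if k < ?n then a (f k) else 0 :: nat)" for a
  define g where "g = inv_into {..<?n} f"
  have g: "g i < ?n" "f (g i) = i" if "i \<in> V" for i
    using that f bij_betw_inv_into_right[OF f that] bij_betwE[OF bij_betw_inv_into[OF f]]
    by (auto simp: g_def)
  have fV: "f k \<in> V" "g (f k) = k" if "k < ?n" for k
    using that f bij_betwE[OF f] bij_betw_inv_into_left[OF f] by (auto simp: g_def)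
  have sub: "S \<subseteq> monomials V" using S by (auto simp: multicomplex_def)
  have deg: "sum (\<phi> a) {..<?n} = sum a V" for a
    using sum.reindex_bij_betw[OF f, of a] by (simp add: \<phi>_def)
  have inj: "inj_on \<phi> (monomials V)"
  proof (rule inj_onI)
    fix a c assume ac: "a \<in> monomials V" "c \<in> monomials V" "\<phi> a = \<phi> c"
    have "a i = c i" for i
    proof (cases "i \<in> V")
      case True
      then show ?thesis using fun_cong[OF ac(3), of "g i"] g[of i] by (simp add: \<phi>_def)
    qed (use ac in \<open>simp add: monomials_def\<close>)
    then show "a = c" by (rule ext)
  qed
  have mc: "multicomplex {..<?n} (\<phi> ` S)"
    unfolding multicomplex_def
  proof (intro conjI ballI allI impI)
    show "finite (\<phi> ` S)" using S by (simp add: multicomplex_def)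
    show "\<phi> ` S \<subseteq> monomials {..<?n}" by (auto simp: \<phi>_def monomials_def)
    fix x c assume "x \<in> \<phi> ` S" and c: "c \<le> x"
    then obtain a where a: "a \<in> S" "x = \<phi> a" by blast
    let ?c = "\<lambda>i. if i \<in> V then c (g i) else 0"
    have "?c i \<le> a i" for i
      using le_funD[OF c, of "g i"] g[of i] by (auto simp: a \<phi>_def)
    then have "?c \<in> S" using S a(1) by (auto simp: multicomplex_def le_fun_def)
    moreover have "c = \<phi> ?c"
    proof
      fix k show "c k = \<phi> ?c k"
        using le_funD[OF c, of k] fV[of k] by (auto simp: a \<phi>_def)
    qed
    ultimately show "c \<in> \<phi> ` S" by blast
  qed
  have "pure_multicomplex {..<?n} (\<phi> ` S)"
  proof (rule pure_multicomplexI[OF mc])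
    fix x assume "x \<in> \<phi> ` S"
    then obtain a where a: "a \<in> S" "x = \<phi> a" by blast
    obtain c where c: "c \<in> S" "a \<le> c" "sum c V = d" using extends[OF a(1)] by blast
    have "x \<le> \<phi> c" using c(2) by (simp add: a \<phi>_def le_fun_def)
    then show "\<exists>c\<in>\<phi> ` S. x \<le> c \<and> sum c {..<?n} = d" using c by (auto simp: deg)
  qed
  moreover have "degree_sequence {..<?n} (\<phi> ` S) = degree_sequence V S"
  proof
    fix k
    have "{x \<in> \<phi> ` S. sum x {..<?n} = k} = \<phi> ` {a \<in> S. sum a V = k}"
      by (auto simp: deg)
    moreover have "card (\<phi> ` {a \<in> S. sum a V = k}) = card {a \<in> S. sum a V = k}"
      by (rule card_image, rule inj_on_subset[OF inj]) (use sub in auto)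
    ultimately show "degree_sequence {..<?n} (\<phi> ` S) k = degree_sequence V S k"
      by (simp add: degree_sequence_def)
  qed
  ultimately show ?thesis unfolding pure_O_sequence_def by blast
qed


section \<open>From a fibre system to a pure O-sequence\<close>

context matroid_with_basis
begin

text \<open>The requirement that a vector has to satisfy at a stratum that can be fired from it.\<close>

definition obeys :: "('a set \<Rightarrow> ('a \<Rightarrow> nat) set) \<Rightarrow> 'a set \<Rightarrow> ('a \<Rightarrow> nat) \<Rightarrow> bool" where
  "obeys F \<tau> a \<longleftrightarrow> dead M B0 \<tau> \<and> (\<lambda>i. vec_restrict a \<tau> i - b \<tau> i) \<in> F \<tau>"

lemma fibre_iff:
  "fibre M B0 F \<sigma> S \<longleftrightarrow> dead M B0 \<sigma> \<and> fibre_shape M B0 \<sigma> S \<and>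
     (\<forall>m\<in>S. \<forall>\<tau>. stratum M B0 \<tau> \<and> \<tau> \<subset> \<sigma> \<and> can_be_fired M B0 \<tau> (\<lambda>i. b \<sigma> i + m i) \<longrightarrow>
        obeys F \<tau> (\<lambda>i. b \<sigma> i + m i))"
  unfolding fibre_def obeys_def Let_def by (rule refl)

lemma fibre_shape_props:
  assumes "fibre_shape M B0 \<sigma> S"
  shows "S \<subseteq> monomials \<sigma>" "finite S" "\<And>a c. a \<in> S \<Longrightarrow> c \<le> a \<Longrightarrow> c \<in> S"
    "pure_multicomplex \<sigma> S" "degree_sequence \<sigma> S = h_vector (dead_node M B0 \<sigma>)"
  using assms unfolding fibre_shape_def pure_multicomplex_def multicomplex_def by auto

lemma coeff_minor_poly_below: "k < card V \<Longrightarrow> coeff (minor_poly M V X) k = 0"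
  unfolding minor_poly_def coeff_sum
  by (intro sum.neutral) (auto simp: coeff_monom_mult dest: card_mono[OF indep_finite])

lemma generating_poly_fibre:
  assumes "dead M B0 \<sigma>" "fibre_shape M B0 \<sigma> S"
  shows "monom 1 (card (U \<sigma>)) * generating_poly \<sigma> S = minor_poly M (U \<sigma>) (A \<sigma>)"
proof (rule poly_eqI)
  fix k
  show "coeff (monom 1 (card (U \<sigma>)) * generating_poly \<sigma> S) k = coeff (minor_poly M (U \<sigma>) (A \<sigma>)) k"
    using fibre_shape_props[OF assms(2)] h_vector_dead_node[OF assms(1), of "k - card (U \<sigma>)"]
    by (simp add: coeff_monom_mult coeff_minor_poly_below coeff_generating_poly)
qed

text \<open>Every \<open>i \<in> \<tau>\<close> lies on \<open>C i\<close> and on no other of the circuits, so its baseline is at least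
  one.\<close>

lemma fired_positive:
  assumes "stratum M B0 \<tau>" "can_be_fired M B0 \<tau> a" "i \<in> \<tau>"
  shows "0 < a i"
proof -
  have "\<tau> \<subseteq> R" using assms(1) by (simp add: stratum_iff)
  then have "i \<in> C i \<inter> U \<tau>" using assms(3) self_in_C[of i] stratum_subset_U[of \<tau>] by auto
  then have "C i \<inter> U \<tau> \<noteq> {}" by blast
  then have "0 < b \<tau> i" using assms(3) finite_U by (simp add: baseline_def card_gt_0_iff)
  also have "b \<tau> i \<le> a i" using assms(2,3) by (simp add: can_be_fired_def)
  finally show ?thesis .
qed

lemma fired_subset:
  assumes "stratum M B0 \<tau>" "can_be_fired M B0 \<tau> a" "a \<in> monomials \<sigma>"
  shows "\<tau> \<subseteq> \<sigma>"
proof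
  fix i assume "i \<in> \<tau>"
  then have "a i \<noteq> 0" using fired_positive[OF assms(1,2)] by simp
  then show "i \<in> \<sigma>" using assms(3) by (auto simp: monomials_def)
qed

text \<open>The set of vectors that is to become the pure multicomplex for \<open>M\<close>; if all strata are
  live, these are the analogues of parking functions.\<close>

definition assembled :: "('a set \<Rightarrow> ('a \<Rightarrow> nat) set) \<Rightarrow> ('a \<Rightarrow> nat) set" where
  "assembled F = {a \<in> monomials R. \<forall>\<tau>. stratum M B0 \<tau> \<and> can_be_fired M B0 \<tau> a \<longrightarrow> obeys F \<tau> a}"

lemma monomials_mono: "\<sigma> \<subseteq> \<tau> \<Longrightarrow> monomials \<sigma> \<subseteq> monomials \<tau>"
  by (auto simp: monomials_def)

text \<open>Baselines grow when the stratum shrinks, so a coordinate below its baseline at \<open>\<sigma>\<close> takes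
  part in no firing inside \<open>\<sigma>\<close>, whatever its value is.\<close>

lemma assembled_drop:
  assumes s: "\<sigma> \<subseteq> R" "i \<in> \<sigma>" and a: "a \<in> monomials \<sigma>" "a i < b \<sigma> i"
  shows "a \<in> assembled F \<longleftrightarrow> a(i := 0) \<in> assembled F"
proof -
  have a0: "a(i := 0) \<in> monomials \<sigma>" using a(1) by (simp add: monomials_def)
  have fired: "can_be_fired M B0 \<tau> a \<longleftrightarrow> can_be_fired M B0 \<tau> (a(i := 0))"
    and notin: "can_be_fired M B0 \<tau> (a(i := 0)) \<Longrightarrow> i \<notin> \<tau>" if \<tau>: "stratum M B0 \<tau>" for \<tau>
  proof -
    show notin0: "i \<notin> \<tau>" if "can_be_fired M B0 \<tau> (a(i := 0))"
      using fired_positive[OF \<tau> that, of i] by auto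
    have notin: "i \<notin> \<tau>" if f: "can_be_fired M B0 \<tau> a"
    proof
      assume "i \<in> \<tau>"
      then have "b \<sigma> i \<le> b \<tau> i" using fired_subset[OF \<tau> f a(1)] s(1) baseline_antimono by blast
      then show False using f \<open>i \<in> \<tau>\<close> a(2) by (auto simp: can_be_fired_def)
    qed
    have "can_be_fired M B0 \<tau> a \<longleftrightarrow> can_be_fired M B0 \<tau> (a(i := 0))" if "i \<notin> \<tau>"
      using that unfolding can_be_fired_def by (intro ball_cong) auto
    then show "can_be_fired M B0 \<tau> a \<longleftrightarrow> can_be_fired M B0 \<tau> (a(i := 0))"
      using notin notin0 by blast
  qed
  have same: "obeys F \<tau> (a(i := 0)) \<longleftrightarrow> obeys F \<tau> a" if "i \<notin> \<tau>" for \<tau>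
  proof -
    have "vec_restrict (a(i := 0)) \<tau> = vec_restrict a \<tau>" using that by (auto simp: vec_restrict_def)
    then show ?thesis by (simp add: obeys_def)
  qed
  have "a \<in> monomials R" "a(i := 0) \<in> monomials R" using a(1) a0 monomials_mono[OF s(1)] by blast+
  then show ?thesis unfolding assembled_def using fired notin same by blast
qed

text \<open>When \<open>\<sigma>\<close> itself can be fired, the condition at \<open>\<sigma>\<close> implies all others: for the smaller
  strata this is the compatibility that a fibre has by definition.\<close>

lemma assembled_fired:
  assumes F: "fibre_system M B0 F" and s: "stratum M B0 \<sigma>"
    and a: "a \<in> monomials \<sigma>" "can_be_fired M B0 \<sigma> a"
  shows "a \<in> assembled F \<longleftrightarrow> dead M B0 \<sigma> \<and> (\<lambda>i. a i - b \<sigma> i) \<in> F \<sigma>"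
proof -
  have sR: "\<sigma> \<subseteq> R" using s by (simp add: stratum_iff)
  have "vec_restrict a \<sigma> = a" using a(1) by (auto simp: vec_restrict_def monomials_def)
  then have obeys: "obeys F \<sigma> a \<longleftrightarrow> dead M B0 \<sigma> \<and> (\<lambda>i. a i - b \<sigma> i) \<in> F \<sigma>"
    by (simp add: obeys_def)
  show ?thesis
  proof
    assume "a \<in> assembled F"
    then show "dead M B0 \<sigma> \<and> (\<lambda>i. a i - b \<sigma> i) \<in> F \<sigma>"
      using s a(2) unfolding obeys[symmetric] by (simp add: assembled_def)
  next
    assume d: "dead M B0 \<sigma> \<and> (\<lambda>i. a i - b \<sigma> i) \<in> F \<sigma>"
    have "b \<sigma> i \<le> a i" for i
      using a by (cases "i \<in> \<sigma>") (auto simp: can_be_fired_def baseline_def)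
    then have a_eq: "(\<lambda>i. b \<sigma> i + (a i - b \<sigma> i)) = a" by simp
    have "fibre M B0 F \<sigma> (F \<sigma>)" using F d by (simp add: fibre_system_def)
    then have "\<forall>m\<in>F \<sigma>. \<forall>\<tau>. stratum M B0 \<tau> \<and> \<tau> \<subset> \<sigma> \<and> can_be_fired M B0 \<tau> (\<lambda>i. b \<sigma> i + m i) \<longrightarrow>
        obeys F \<tau> (\<lambda>i. b \<sigma> i + m i)"
      unfolding fibre_iff by (elim conjE)
    note small = bspec[OF this conjunct2[OF d], unfolded a_eq, rule_format]
    have "obeys F \<tau> a" if \<tau>: "stratum M B0 \<tau>" "can_be_fired M B0 \<tau> a" for \<tau>
    proof (cases "\<tau> = \<sigma>")
      case True
      then show ?thesis using obeys d by simp
    next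
      case False
      then have "\<tau> \<subset> \<sigma>" using fired_subset[OF \<tau> a(1)] by simp
      then show ?thesis using small[of \<tau>] \<tau> by simp
    qed
    then show "a \<in> assembled F"
      using a(1) monomials_mono[OF sR] by (auto simp: assembled_def)
  qed
qed

text \<open>The strata \<open>{i}\<close> are live, so they can never be fired.\<close>

lemma assembled_bounded:
  assumes "a \<in> assembled F" shows "a i \<le> card (ground M)"
proof (cases "i \<in> R")
  case True
  have "\<not> can_be_fired M B0 {i} a"
    using assms True singleton_live[of i] by (auto simp: assembled_def stratum_iff obeys_def)
  then have "a i < card (C i)" using True by (simp add: can_be_fired_def baseline_singleton)
  also have "\<dots> \<le> card (ground M)" using C_ground[OF True] finite_ground by (rule card_mono[rotated])
  finally show ?thesis by simp
next
  case False
  then have "a i = 0" using assms by (simp add: assembled_def monomials_def)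
  then show ?thesis by simp
qed

lemma finite_assembled: "finite (assembled F)"
proof (rule finite_subset)
  show "assembled F \<subseteq> {f. \<forall>x. (x \<in> R \<longrightarrow> f x \<in> {..card (ground M)}) \<and> (x \<notin> R \<longrightarrow> f x = 0)}"
    using assembled_bounded by (auto simp: assembled_def monomials_def)
  show "finite {f. \<forall>x. (x \<in> R \<longrightarrow> f x \<in> {..card (ground M)}) \<and> (x \<notin> R \<longrightarrow> f x = (0::nat))}"
    by (rule finite_set_of_finite_funs) (auto simp: finite_R)
qed

lemma multicomplex_assembled:
  assumes F: "fibre_system M B0 F" shows "multicomplex R (assembled F)"
  unfolding multicomplex_def
proof (intro conjI ballI allI impI finite_assembled)
  show "assembled F \<subseteq> monomials R" by (auto simp: assembled_def)
  fix a c assume a: "a \<in> assembled F" and le: "c \<le> a"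
  have "obeys F \<tau> c" if \<tau>: "stratum M B0 \<tau>" "can_be_fired M B0 \<tau> c" for \<tau>
  proof -
    have "can_be_fired M B0 \<tau> a" using \<tau>(2) le by (auto simp: can_be_fired_def le_fun_def intro: order_trans)
    then have o: "obeys F \<tau> a" using a \<tau>(1) by (simp add: assembled_def)
    then have "fibre_shape M B0 \<tau> (F \<tau>)" using F by (simp add: fibre_system_def obeys_def fibre_def)
    moreover have "(\<lambda>i. vec_restrict c \<tau> i - b \<tau> i) \<le> (\<lambda>i. vec_restrict a \<tau> i - b \<tau> i)"
      using le by (auto simp: le_fun_def vec_restrict_def intro: diff_le_mono)
    ultimately show ?thesis using o fibre_shape_props(3) by (auto simp: obeys_def)
  qed
  moreover have "c i = 0" if "i \<notin> R" for i
    using le_funD[OF le, of i] a that by (simp add: assembled_def monomials_def)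
  then have "c \<in> monomials R" by (auto simp: monomials_def)
  ultimately show "c \<in> assembled F" by (simp add: assembled_def)
qed

text \<open>The counterpart of contracting \<open>W\<close>: each element of \<open>W\<close> on \<open>C i\<close> stands for one unit that
  \<open>a i\<close> is already known to have.\<close>

definition slice :: "('a set \<Rightarrow> ('a \<Rightarrow> nat) set) \<Rightarrow> 'a set \<Rightarrow> 'a set \<Rightarrow> ('a \<Rightarrow> nat) set" where
  "slice F \<sigma> W = {a \<in> assembled F \<inter> monomials \<sigma>. \<forall>i\<in>\<sigma>. card (W \<inter> C i) \<le> a i}"

lemma finite_slice: "finite (slice F \<sigma> W)"
  using finite_assembled by (simp add: slice_def)

text \<open>The same recursion as in \<open>minor_poly_burn\<close>: the second summand collects the vectors with
  \<open>a i\<close> larger than the current bound, the first those with equality, from which the coordinate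
  \<open>i\<close> may be erased.\<close>

lemma generating_poly_slice_burn:
  assumes s: "\<sigma> \<subseteq> R" "i \<in> \<sigma>" and W: "W \<subseteq> U \<sigma>" and e: "e \<in> C i \<inter> U \<sigma>" "e \<notin> W"
  shows "generating_poly R (slice F \<sigma> W) =
    monom 1 (card (W \<inter> C i)) * generating_poly R (slice F (\<sigma> - {i}) (W - C i)) +
    generating_poly R (slice F \<sigma> (insert e W))"
proof -
  let ?w = "card (W \<inter> C i)" and ?S' = "slice F (\<sigma> - {i}) (W - C i)"
  have fW: "finite W" using W finite_U finite_subset by blast
  have e_C: "e \<notin> C j" if "j \<in> \<sigma>" "j \<noteq> i" for j
    using e(1) that s(2) unfolding Int_iff in_U_iff[OF s(1)] by blast
  have W_C: "W \<inter> C i \<inter> C j = {}" if "j \<in> \<sigma>" "j \<noteq> i" for j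
  proof -
    have False if "x \<in> U \<sigma>" "x \<in> C i" "x \<in> C j" for x
      using that \<open>j \<in> \<sigma>\<close> \<open>j \<noteq> i\<close> s(2) unfolding in_U_iff[OF s(1)] by blast
    then show ?thesis using W by blast
  qed
  have w_lt: "?w < b \<sigma> i"
  proof -
    have "W \<inter> C i \<subset> C i \<inter> U \<sigma>" using W e by blast
    then show ?thesis using s(2) finite_U by (simp add: baseline_def psubset_card_mono)
  qed
  have ins: "card (insert e W \<inter> C j) = card (W \<inter> C j) + (if j = i then 1 else 0)" if "j \<in> \<sigma>" for j
    using that e_C[of j] e fW by (auto simp: Int_insert_left)
  have split: "slice F \<sigma> W = {a \<in> slice F \<sigma> W. a i = ?w} \<union> slice F \<sigma> (insert e W)"
    using s(2) ins by (auto simp: slice_def le_Suc_eq Suc_le_eq)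
  have disj: "{a \<in> slice F \<sigma> W. a i = ?w} \<inter> slice F \<sigma> (insert e W) = {}"
    using s(2) ins by (auto simp: slice_def)
  have fin: "finite {a \<in> slice F \<sigma> W. a i = ?w}" using finite_slice by simp
  have up: "c(i := ?w) \<in> assembled F \<longleftrightarrow> c \<in> assembled F" if "c \<in> monomials (\<sigma> - {i})" for c
  proof -
    have "c(i := ?w) \<in> monomials \<sigma>" "(c(i := ?w))(i := 0) = c"
      using that s(2) by (auto simp: monomials_def)
    then show ?thesis using assembled_drop[OF s, of "c(i := ?w)" F] w_lt by simp
  qed
  have "{a \<in> slice F \<sigma> W. a i = ?w} = (\<lambda>c. c(i := ?w)) ` ?S'"
  proof (intro equalityI subsetI)
    fix a assume "a \<in> {a \<in> slice F \<sigma> W. a i = ?w}"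
    then have a: "a \<in> assembled F" "a \<in> monomials \<sigma>" "\<forall>j\<in>\<sigma>. card (W \<inter> C j) \<le> a j" "a i = ?w"
      by (auto simp: slice_def)
    have m: "a(i := 0) \<in> monomials (\<sigma> - {i})" using a(2) by (auto simp: monomials_def)
    have eq: "a = (a(i := 0))(i := ?w)" using a(4) by auto
    have "card ((W - C i) \<inter> C j) \<le> (a(i := 0)) j" if "j \<in> \<sigma> - {i}" for j
    proof -
      have "card ((W - C i) \<inter> C j) \<le> card (W \<inter> C j)" using fW by (intro card_mono) auto
      then show ?thesis using a(3) that by (auto intro: order_trans)
    qed
    then have "a(i := 0) \<in> ?S'" using up[OF m] eq a(1) m by (simp add: slice_def)
    then show "a \<in> (\<lambda>c. c(i := ?w)) ` ?S'" using eq by blast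
  next
    fix a assume "a \<in> (\<lambda>c. c(i := ?w)) ` ?S'"
    then obtain c where c: "a = c(i := ?w)" "c \<in> assembled F" "c \<in> monomials (\<sigma> - {i})"
      "\<forall>j\<in>\<sigma> - {i}. card ((W - C i) \<inter> C j) \<le> c j" by (auto simp: slice_def)
    have "card (W \<inter> C j) \<le> a j" if j: "j \<in> \<sigma>" for j
    proof (cases "j = i")
      case False
      then have "W \<inter> C j = (W - C i) \<inter> C j" using W_C[OF j] by blast
      then show ?thesis using c False j by simp
    qed (simp add: c)
    moreover have "a \<in> monomials \<sigma>" using c s(2) by (auto simp: monomials_def)
    ultimately show "a \<in> {a \<in> slice F \<sigma> W. a i = ?w}" using up[OF c(3)] c by (simp add: slice_def)
  qed
  moreover have "inj_on (\<lambda>c. c(i := ?w)) ?S'"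
  proof (rule inj_onI)
    fix c d assume cd: "c \<in> ?S'" "d \<in> ?S'" and eq: "c(i := ?w) = d(i := ?w)"
    have "c i = 0" "d i = 0" using cd by (auto simp: slice_def monomials_def)
    then show "c = d" using eq by (metis fun_upd_triv fun_upd_upd)
  qed
  moreover have "sum (c(i := ?w)) R = ?w + sum c R" if "c \<in> ?S'" for c
  proof -
    have iR: "i \<in> R" using s by blast
    have "c i = 0" using that by (auto simp: slice_def monomials_def)
    then show ?thesis using iR finite_R by (simp add: sum.remove[OF finite_R iR])
  qed
  ultimately have "generating_poly R {a \<in> slice F \<sigma> W. a i = ?w} = monom 1 ?w * generating_poly R ?S'"
    unfolding generating_poly_def by (simp add: sum.reindex sum_distrib_left mult_monom)
  moreover have "generating_poly R (slice F \<sigma> W) =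
      generating_poly R {a \<in> slice F \<sigma> W. a i = ?w} + generating_poly R (slice F \<sigma> (insert e W))"
    unfolding generating_poly_def by (subst split) (rule sum.union_disjoint[OF fin finite_slice disj])
  ultimately show ?thesis by simp
qed

lemma A_empty: "A {} = {}" and U_empty: "U {} = {}"
  by (simp_all add: A_set_def U_set_def multiplicity_def)

lemma zero_in_assembled: "(\<lambda>i. 0) \<in> assembled F"
proof -
  have "\<not> can_be_fired M B0 \<tau> (\<lambda>i. 0)" if \<tau>: "stratum M B0 \<tau>" for \<tau>
  proof
    assume fired: "can_be_fired M B0 \<tau> (\<lambda>i. 0)"
    obtain i where "i \<in> \<tau>" using \<tau> by (auto simp: stratum_iff)
    then show False using fired_positive[OF \<tau> fired] by simp
  qed
  then show ?thesis unfolding assembled_def by (auto simp: monomials_def)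
qed

text \<open>The bound has reached the baseline, so \<open>\<sigma>\<close> can be fired from every vector of the slice.
  For dead \<open>\<sigma>\<close> the slice is the translate of the fibre by the baseline, for live \<open>\<sigma>\<close> it is
  empty; the empty stratum contributes the zero vector.\<close>

lemma generating_poly_slice_top:
  assumes F: "fibre_system M B0 F" and s: "\<sigma> \<subseteq> R"
  shows "generating_poly R (slice F \<sigma> (U \<sigma>)) = minor_poly M (U \<sigma>) (A \<sigma>)"
proof (cases "\<sigma> = {}")
  case True
  have "slice F {} {} = {\<lambda>i. 0}" using zero_in_assembled by (auto simp: slice_def monomials_def)
  then show ?thesis using minor_poly_self[OF indep_empty]
    by (simp add: True U_empty A_empty generating_poly_def)
next
  case False
  have st: "stratum M B0 \<sigma>" using False s by (simp add: stratum_iff)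
  have low: "(\<forall>i\<in>\<sigma>. card (U \<sigma> \<inter> C i) \<le> a i) \<longleftrightarrow> can_be_fired M B0 \<sigma> a" for a
    by (simp add: can_be_fired_def baseline_def Int_commute)
  show ?thesis
  proof (cases "dead M B0 \<sigma>")
    case True
    then have sh: "fibre_shape M B0 \<sigma> (F \<sigma>)" using F by (simp add: fibre_system_def fibre_def)
    note sh' = fibre_shape_props[OF sh]
    have "slice F \<sigma> (U \<sigma>) = (\<lambda>m i. b \<sigma> i + m i) ` F \<sigma>"
    proof (intro equalityI subsetI)
      fix a assume "a \<in> slice F \<sigma> (U \<sigma>)"
      then have a: "a \<in> assembled F" "a \<in> monomials \<sigma>" "can_be_fired M B0 \<sigma> a"
        by (auto simp: slice_def low)
      have "b \<sigma> i \<le> a i" for i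
        using a(3) by (cases "i \<in> \<sigma>") (auto simp: can_be_fired_def baseline_def)
      then have "a = (\<lambda>i. b \<sigma> i + (a i - b \<sigma> i))" by simp
      moreover have "(\<lambda>i. a i - b \<sigma> i) \<in> F \<sigma>" using assembled_fired[OF F st a(2,3)] a(1) by simp
      ultimately show "a \<in> (\<lambda>m i. b \<sigma> i + m i) ` F \<sigma>" by (rule image_eqI)
    next
      fix a assume "a \<in> (\<lambda>m i. b \<sigma> i + m i) ` F \<sigma>"
      then obtain m where m: "m \<in> F \<sigma>" "a = (\<lambda>i. b \<sigma> i + m i)" by blast
      have "a \<in> monomials \<sigma>" "can_be_fired M B0 \<sigma> a"
        using m sh'(1) baseline_monomial[of \<sigma>] by (auto simp: monomials_def can_be_fired_def)
      then show "a \<in> slice F \<sigma> (U \<sigma>)"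
        using assembled_fired[OF F st, of a] m True by (simp add: slice_def low)
    qed
    moreover have "inj_on (\<lambda>m i. b \<sigma> i + m i) (F \<sigma>)"
      by (auto simp: inj_on_def fun_eq_iff)
    moreover have "sum (\<lambda>i. b \<sigma> i + m i) R = card (U \<sigma>) + sum m \<sigma>" if "m \<in> F \<sigma>" for m
      using that sh'(1) sum_monomial[OF baseline_monomial s finite_R] sum_monomial[of m \<sigma> R] s finite_R
      by (auto simp: sum.distrib sum_baseline[OF s])
    ultimately have "generating_poly R (slice F \<sigma> (U \<sigma>)) = monom 1 (card (U \<sigma>)) * generating_poly \<sigma> (F \<sigma>)"
      unfolding generating_poly_def by (simp add: sum.reindex sum_distrib_left mult_monom)
    then show ?thesis using generating_poly_fibre[OF True sh] by simp
  next
    case live: False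
    then have "slice F \<sigma> (U \<sigma>) = {}"
      using assembled_fired[OF F st] by (auto simp: slice_def low)
    moreover have "\<not> indep M (U \<sigma>)" using live st by (simp add: dead_def)
    ultimately show ?thesis by (simp add: generating_poly_def minor_poly_dependent)
  qed
qed

text \<open>Both sides satisfy the same recursion, which lowers \<open>|\<sigma>|\<close> or else enlarges \<open>W\<close>, and agree
  where it stops.\<close>

theorem generating_poly_slice:
  assumes F: "fibre_system M B0 F" and "\<sigma> \<subseteq> R" "W \<subseteq> U \<sigma>"
  shows "generating_poly R (slice F \<sigma> W) = minor_poly M W (A \<sigma>)"
  using assms(2,3)
proof (induction "card \<sigma>" arbitrary: \<sigma> W rule: less_induct)
  case outer: less
  show ?case using outer.prems(2)
  proof (induction "card (U \<sigma> - W)" arbitrary: W rule: less_induct)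
    case inner: less
    show ?case
    proof (cases "W = U \<sigma>")
      case True
      then show ?thesis using generating_poly_slice_top[OF F outer.prems(1)] by simp
    next
      case False
      then obtain e where e: "e \<in> U \<sigma>" "e \<notin> W" using inner.prems by blast
      then obtain i where i: "i \<in> \<sigma>" "e \<in> C i \<inter> U \<sigma>" using in_U_iff[OF outer.prems(1), of e] by blast
      have "\<sigma> - {i} \<subseteq> R" using outer.prems(1) by blast
      moreover have "card (\<sigma> - {i}) < card \<sigma>"
        using finite_stratum[OF outer.prems(1)] i(1) by (rule card_Diff1_less)
      moreover have "W - C i \<subseteq> U (\<sigma> - {i})"
      proof
        fix x assume x: "x \<in> W - C i"
        then have "x \<in> U \<sigma>" using inner.prems by blast
        then obtain j where j: "j \<in> \<sigma>" "x \<in> C j" "\<forall>k\<in>\<sigma>. x \<in> C k \<longrightarrow> k = j"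
          unfolding in_U_iff[OF outer.prems(1)] by blast
        then have "j \<in> \<sigma> - {i}" using x by blast
        then show "x \<in> U (\<sigma> - {i})"
          unfolding in_U_iff[OF \<open>\<sigma> - {i} \<subseteq> R\<close>] using j by blast
      qed
      ultimately have 1: "generating_poly R (slice F (\<sigma> - {i}) (W - C i)) = minor_poly M (W - C i) (A (\<sigma> - {i}))"
        by (intro outer.hyps)
      have "U \<sigma> - insert e W \<subset> U \<sigma> - W" using e by blast
      then have "card (U \<sigma> - insert e W) < card (U \<sigma> - W)" by (intro psubset_card_mono) (simp_all add: finite_U)
      then have 2: "generating_poly R (slice F \<sigma> (insert e W)) = minor_poly M (insert e W) (A \<sigma>)"
        using e inner.prems by (intro inner.hyps) auto
      show ?thesis
        unfolding generating_poly_slice_burn[OF outer.prems(1) i(1) inner.prems i(2) e(2)]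
          minor_poly_burn[OF outer.prems(1) i(1) inner.prems i(2) e(2)] 1 2 ..
    qed
  qed
qed

corollary degree_sequence_assembled:
  assumes "fibre_system M B0 F"
  shows "degree_sequence R (assembled F) = h_vector M"
proof -
  have "slice F R {} = assembled F" by (auto simp: slice_def assembled_def)
  then have "generating_poly R (assembled F) = minor_poly M {} (A R)"
    using generating_poly_slice[OF assms order_refl, of "{}"] by simp
  also have "\<dots> = minor_poly M {} (ground M)"
  proof -
    \<comment> \<open>The elements of \<open>B0\<close> on none of the circuits are coloops of \<open>M\<close>.\<close>
    let ?D = "B0 - A R"
    have RA: "R \<subseteq> A R" using stratum_subset_U U_subset_A by blast
    have un: "A R \<union> ?D = ground M" using RA A_ground B0_subset by blast
    have "card B0 = card (A R \<inter> B0) + card ?D"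
      using card_Int_Diff[OF finite_B0, of "A R"] by (simp add: Int_commute)
    then have "rank_of M (A R \<union> ?D) = rank_of M (A R) + card ?D"
      unfolding un using card_B0 rank_A[OF order_refl] by simp
    then have "minor_poly M ({} \<union> {}) (A R \<union> ?D) = monom 1 (card ({} :: 'a set)) * minor_poly M {} (A R)"
      by (intro minor_poly_coloops) (auto simp: finite_B0)
    then show ?thesis unfolding un by simp
  qed
  finally have "generating_poly R (assembled F) = minor_poly M {} (ground M)" .
  then show ?thesis
    by (intro ext) (simp add: h_vector_eq flip: coeff_generating_poly[OF finite_assembled])
qed

lemma fibre_extends_to_top:
  assumes d: "dead M B0 \<sigma>" and sh: "fibre_shape M B0 \<sigma> S" and m: "m \<in> S"
  obtains x where "x \<in> S" "m \<le> x" "sum x \<sigma> = rank_of M (A \<sigma>) - card (U \<sigma>)"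
proof -
  have s: "\<sigma> \<subseteq> R" using d by (simp add: dead_iff)
  note sh' = fibre_shape_props[OF sh]
  have "0 < coeff (minor_poly M (U \<sigma>) (A \<sigma>)) (rank_of M (A \<sigma>))"
    using d U_subset_A[OF s] no_coloop_in_A[OF s]
    by (intro top_coeff_minor_poly_pos finite_A) (auto simp: dead_iff)
  then have "degree_sequence \<sigma> S (rank_of M (A \<sigma>) - card (U \<sigma>)) \<noteq> 0"
    using card_U_le_rank_A[OF d] by (simp add: sh'(5) h_vector_dead_node[OF d])
  moreover have "degree_sequence \<sigma> S k = 0" if "rank_of M (A \<sigma>) - card (U \<sigma>) < k" for k
    using that by (simp add: sh'(5) h_vector_def rank_dead_node[OF d])
  ultimately show ?thesis
    using pure_extend[OF sh'(4) finite_stratum[OF s] _ _ m] that by blast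
qed

text \<open>Burn the coordinates below their baseline one after the other, raising each of them to the
  largest value at which it still burns, and fill up the fibre at the stratum where the process
  stops. The degrees add up to \<open>|A \<sigma>| - |\<sigma>|\<close>, because each element of \<open>A \<sigma>\<close> is counted in the
  step in which it gets uncovered.\<close>

lemma assembled_extends_to_top:
  assumes F: "fibre_system M B0 F" and "\<sigma> \<subseteq> R" "a \<in> assembled F" "a \<in> monomials \<sigma>"
  shows "\<exists>c \<in> assembled F \<inter> monomials \<sigma>. a \<le> c \<and> sum c \<sigma> + card \<sigma> = card (A \<sigma>)"
  using assms(2-)
proof (induction "card \<sigma>" arbitrary: \<sigma> a rule: less_induct)
  case less
  note s = less.prems(1)
  show ?case
  proof (cases "\<sigma> \<noteq> {} \<and> can_be_fired M B0 \<sigma> a")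
    case True
    then have st: "stratum M B0 \<sigma>" using s by (simp add: stratum_iff)
    have dm: "dead M B0 \<sigma>" "(\<lambda>i. a i - b \<sigma> i) \<in> F \<sigma>"
      using assembled_fired[OF F st less.prems(3)] True less.prems(2) by auto
    have sh: "fibre_shape M B0 \<sigma> (F \<sigma>)" using F dm by (simp add: fibre_system_def fibre_def)
    obtain x where x: "x \<in> F \<sigma>" "(\<lambda>i. a i - b \<sigma> i) \<le> x" "sum x \<sigma> = rank_of M (A \<sigma>) - card (U \<sigma>)"
      using fibre_extends_to_top[OF dm(1) sh dm(2)] .
    let ?c = "\<lambda>i. b \<sigma> i + x i"
    have c: "?c \<in> monomials \<sigma>" "can_be_fired M B0 \<sigma> ?c"
      using x(1) fibre_shape_props(1)[OF sh] baseline_monomial[of \<sigma>]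
      by (auto simp: monomials_def can_be_fired_def)
    have "?c \<in> assembled F" using assembled_fired[OF F st c] x(1) dm(1) by simp
    moreover have "a \<le> ?c" using x(2) by (simp add: le_fun_def le_diff_conv add.commute)
    moreover have "sum ?c \<sigma> + card \<sigma> = card (A \<sigma>)"
      using card_U_le_rank_A[OF dm(1)] by (simp add: sum.distrib sum_baseline[OF s] x(3) card_A[OF s])
    ultimately show ?thesis using c(1) by blast
  next
    case False
    show ?thesis
    proof (cases "\<sigma> = {}")
      case True
      then show ?thesis using less.prems by (auto simp: A_empty)
    next
      case ne: False
      then obtain i where i: "i \<in> \<sigma>" "a i < b \<sigma> i" using False by (auto simp: can_be_fired_def not_le)
      have s': "\<sigma> - {i} \<subseteq> R" using s by blast
      have lt: "card (\<sigma> - {i}) < card \<sigma>" using finite_stratum[OF s] i(1) by (rule card_Diff1_less)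
      have a0: "a(i := 0) \<in> assembled F" "a(i := 0) \<in> monomials (\<sigma> - {i})"
        using assembled_drop[OF s i(1) less.prems(3) i(2)] less.prems(2,3) by (auto simp: monomials_def)
      obtain c where c: "c \<in> assembled F" "c \<in> monomials (\<sigma> - {i})" "a(i := 0) \<le> c"
        "sum c (\<sigma> - {i}) + card (\<sigma> - {i}) = card (A (\<sigma> - {i}))"
        using less.hyps[OF lt s' a0] by blast
      \<comment> \<open>One less than the baseline is the largest value at which \<open>i\<close> still burns.\<close>
      let ?c = "c(i := b \<sigma> i - 1)"
      have m: "?c \<in> monomials \<sigma>" using c(2) i(1) by (auto simp: monomials_def)
      have "?c(i := 0) = c" using c(2) by (auto simp: monomials_def)
      then have "?c \<in> assembled F" using assembled_drop[OF s i(1) m, of F] i(2) c(1) by simp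
      moreover have "a \<le> ?c"
        unfolding le_fun_def
      proof
        fix k show "a k \<le> ?c k" using le_funD[OF c(3), of k] i(2) by (cases "k = i") auto
      qed
      moreover have "sum ?c \<sigma> + card \<sigma> = card (A \<sigma>)"
      proof -
        have "A (\<sigma> - {i}) \<subseteq> A \<sigma>" using A_mono[OF _ s] by blast
        then have "card (A \<sigma>) = card (A (\<sigma> - {i})) + b \<sigma> i"
          using private_part[OF s i(1)] i(1) finite_A[of \<sigma>] finite_A[of "\<sigma> - {i}"]
          by (simp add: baseline_def card_Diff_subset card_mono)
        moreover have "sum ?c \<sigma> = b \<sigma> i - 1 + sum c (\<sigma> - {i})"
          using i(1) finite_stratum[OF s] by (simp add: sum.remove[of \<sigma> i])
        moreover have "card \<sigma> = Suc (card (\<sigma> - {i}))"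
          by (rule card.remove[OF finite_stratum[OF s] i(1)])
        ultimately show ?thesis using c(4) i(2) by simp
      qed
      ultimately show ?thesis using m by blast
    qed
  qed
qed

theorem fibre_system_imp_pure_O_sequence:
  assumes "fibre_system M B0 F" shows "pure_O_sequence (h_vector M)"
proof -
  have "\<exists>c\<in>assembled F. a \<le> c \<and> sum c R = card (A R) - card R" if a: "a \<in> assembled F" for a
  proof -
    have "a \<in> monomials R" using a by (simp add: assembled_def)
    then obtain c where "c \<in> assembled F" "a \<le> c" "sum c R + card R = card (A R)"
      using assembled_extends_to_top[OF assms order_refl a] by auto
    then show ?thesis by (intro bexI[of _ c]) auto
  qed
  then have "pure_O_sequence (degree_sequence R (assembled F))"
    by (rule pure_O_sequenceI[OF finite_R multicomplex_assembled[OF assms]])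
  then show ?thesis by (simp add: degree_sequence_assembled[OF assms])
qed

end


section \<open>Small h-vectors\<close>

context matroid
begin

text \<open>The usual expression of the h-vector by the numbers of independent sets of each size.\<close>

lemma coeff_minor_poly_levels:
  assumes U: "indep M U" "U \<subseteq> A"
  shows "coeff (minor_poly M U A) (card U + k) =
    (\<Sum>j\<le>k. int (card {I. indep M I \<and> U \<subseteq> I \<and> I \<subseteq> A \<and> card I = card U + j}) *
       coeff ([:1, -1:] ^ (rank_of M A - card U - j)) (k - j))"
proof -
  let ?T = "{I. indep M I \<and> U \<subseteq> I \<and> I \<subseteq> A}"
  let ?g = "\<lambda>j. coeff ([:1, -1:] ^ (rank_of M A - card U - j) :: int poly) (k - j)"
  have le: "card U \<le> card I" if "I \<in> ?T" for I
    using that indep_finite[of I] by (auto intro: card_mono)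
  have fin: "finite {I \<in> ?T. card I - card U \<le> k}"
    by (rule finite_subset[OF _ finite_between[of U A]]) auto
  have "coeff (minor_poly M U A) (card U + k) =
      (\<Sum>I\<in>?T. if card I - card U \<le> k then ?g (card I - card U) else 0)"
    unfolding minor_poly_def coeff_sum
  proof (intro sum.cong refl)
    fix I assume I: "I \<in> ?T"
    have "rank_of M A - card U - (card I - card U) = rank_of M A - card I"
      "card U + k - card I = k - (card I - card U)" using le[OF I] by simp_all
    moreover have "card U + k < card I \<longleftrightarrow> \<not> card I - card U \<le> k" using le[OF I] by linarith
    ultimately show "coeff (monom 1 (card I) * [:1, -1:] ^ (rank_of M A - card I)) (card U + k) =
        (if card I - card U \<le> k then ?g (card I - card U) else 0)"
      by (simp only: coeff_monom_mult) simp
  qed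
  also have "\<dots> = (\<Sum>I\<in>{I \<in> ?T. card I - card U \<le> k}. ?g (card I - card U))"
    using finite_between[of U A] by (intro sum.inter_filter[symmetric])
  also have "\<dots> = (\<Sum>j\<le>k. \<Sum>I\<in>{I \<in> {I \<in> ?T. card I - card U \<le> k}. card I - card U = j}. ?g (card I - card U))"
    by (rule sum.group[symmetric]) (use fin in auto)
  also have "\<dots> = (\<Sum>j\<le>k. int (card {I. indep M I \<and> U \<subseteq> I \<and> I \<subseteq> A \<and> card I = card U + j}) * ?g j)"
  proof (intro sum.cong refl)
    fix j assume j: "j \<in> {..k}"
    have "{I \<in> {I \<in> ?T. card I - card U \<le> k}. card I - card U = j} =
        {I. indep M I \<and> U \<subseteq> I \<and> I \<subseteq> A \<and> card I = card U + j}" (is "?L = ?L'")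
    proof (intro equalityI subsetI)
      fix I assume "I \<in> ?L"
      then show "I \<in> ?L'" using le[of I] by auto
    qed (use j in auto)
    then show "(\<Sum>I\<in>?L. ?g (card I - card U)) = int (card ?L') * ?g j" by simp
  qed
  finally show ?thesis .
qed

lemma level_0: "indep M U \<Longrightarrow> U \<subseteq> A \<Longrightarrow> {I. indep M I \<and> U \<subseteq> I \<and> I \<subseteq> A \<and> card I = card U + 0} = {U}"
proof -
  assume U: "indep M U" "U \<subseteq> A"
  have "I = U" if I: "I \<in> {I. indep M I \<and> U \<subseteq> I \<and> I \<subseteq> A \<and> card I = card U + 0}" for I
    using card_subset_eq[of I U] indep_finite[of I] I by simp
  moreover have "U \<in> {I. indep M I \<and> U \<subseteq> I \<and> I \<subseteq> A \<and> card I = card U + 0}" using U by simp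
  ultimately show ?thesis by (intro equalityI subsetI) (simp_all only: singleton_iff)
qed

lemma card_level_1:
  assumes "indep M U" "U \<subseteq> A"
  shows "card {I. indep M I \<and> U \<subseteq> I \<and> I \<subseteq> A \<and> card I = card U + 1} =
    card {x \<in> A - U. indep M (insert x U)}"
proof -
  have "{I. indep M I \<and> U \<subseteq> I \<and> I \<subseteq> A \<and> card I = card U + 1} =
      (\<lambda>x. insert x U) ` {x \<in> A - U. indep M (insert x U)}" (is "?L = ?L'")
  proof (intro equalityI subsetI)
    fix I assume I: "I \<in> ?L"
    then have fI: "finite I" using indep_finite by blast
    then have "card (I - U) = 1" using I indep_finite[OF assms(1)] by (simp add: card_Diff_subset)
    then obtain x where x: "I - U = {x}" by (auto simp: card_1_singleton_iff)
    then have "I = insert x U" "x \<notin> U" using I by auto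
    then show "I \<in> ?L'" using I by auto
  next
    fix I assume "I \<in> ?L'"
    then show "I \<in> ?L" using assms(2) indep_finite[OF assms(1)] by auto
  qed
  moreover have "inj_on (\<lambda>x. insert x U) {x \<in> A - U. indep M (insert x U)}"
    by (auto simp: inj_on_def)
  ultimately show ?thesis by (simp add: card_image)
qed

lemma card_level_2_le:
  assumes "indep M U" "finite A"
  shows "card {I. indep M I \<and> U \<subseteq> I \<and> I \<subseteq> A \<and> card I = card U + 2} \<le>
    card {x \<in> A - U. indep M (insert x U)} choose 2"
proof -
  let ?N = "{x \<in> A - U. indep M (insert x U)}"
  let ?L = "{I. indep M I \<and> U \<subseteq> I \<and> I \<subseteq> A \<and> card I = card U + 2}"
  have fN: "finite ?N" using assms by simp
  have "(\<lambda>I. I - U) ` ?L \<subseteq> {B. B \<subseteq> ?N \<and> card B = 2}"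
  proof clarify
    fix I assume I: "indep M I" "U \<subseteq> I" "I \<subseteq> A" "card I = card U + 2"
    have "card (I - U) = 2" using I indep_finite[OF assms(1)] by (simp add: card_Diff_subset)
    moreover have "indep M (insert x U)" if "x \<in> I" for x
      using that I by (intro indep_mono[OF I(1)]) auto
    ultimately show "I - U \<subseteq> ?N \<and> card (I - U) = 2" using I(3) by auto
  qed
  moreover have "inj_on (\<lambda>I. I - U) ?L" by (auto simp: inj_on_def)
  ultimately have "card ?L \<le> card {B. B \<subseteq> ?N \<and> card B = 2}"
    using fN by (intro card_inj_on_le) auto
  then show ?thesis unfolding n_subsets[OF fN] .
qed

end

context matroid_with_basis
begin

lemma h_vector_dead_node_0: "dead M B0 \<sigma> \<Longrightarrow> h_vector (dead_node M B0 \<sigma>) 0 = 1"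
  using h_vector_dead_node[of \<sigma> 0] coeff_minor_poly_levels[of "U \<sigma>" "A \<sigma>" 0] U_subset_A
  by (simp add: dead_iff level_0[simplified] coeff_linear_poly_power)

lemma h_vector_dead_node_1:
  assumes d: "dead M B0 \<sigma>"
  shows "h_vector (dead_node M B0 \<sigma>) 1 =
    int (card {x \<in> A \<sigma> - U \<sigma>. indep M (insert x (U \<sigma>))}) - int (rank_of M (A \<sigma>) - card (U \<sigma>))"
proof -
  have U: "indep M (U \<sigma>)" "U \<sigma> \<subseteq> A \<sigma>" using d U_subset_A by (auto simp: dead_iff)
  have "coeff ([:1, -1:] ^ n :: int poly) 0 = 1 \<and> coeff ([:1, -1:] ^ n :: int poly) (Suc 0) = - int n" for n
    by (induction n) simp_all
  then show ?thesis
    using h_vector_dead_node[OF d, of 1] coeff_minor_poly_levels[OF U, of 1] level_0[OF U] card_level_1[OF U]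
    by simp
qed

text \<open>Macaulay's bound for the third entry in rank two. With \<open>n\<close> non-loops, \<open>h 1 = n - 2\<close>, and
  at most \<open>n choose 2\<close> bases give \<open>h 2 \<le> (n - 1) choose 2\<close>.\<close>

lemma h_vector_dead_node_2_le:
  assumes d: "dead M B0 \<sigma>" and rk: "rank_of M (A \<sigma>) = card (U \<sigma>) + 2"
  shows "h_vector (dead_node M B0 \<sigma>) 2 \<le> int ((nat (h_vector (dead_node M B0 \<sigma>) 1) + 1) choose 2)"
proof -
  let ?n = "card {x \<in> A \<sigma> - U \<sigma>. indep M (insert x (U \<sigma>))}"
  have U: "indep M (U \<sigma>)" "U \<sigma> \<subseteq> A \<sigma>" using d U_subset_A by (auto simp: dead_iff)
  let ?f2 = "card {I. indep M I \<and> U \<sigma> \<subseteq> I \<and> I \<subseteq> A \<sigma> \<and> card I = card (U \<sigma>) + 2}"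
  have c: "coeff ([:1, -1:] ^ 2 :: int poly) 2 = 1" "coeff ([:1, -1:] :: int poly) (Suc 0) = -1"
    by (simp_all add: coeff_linear_poly_power)
  have h2: "h_vector (dead_node M B0 \<sigma>) 2 = 1 - int ?n + int ?f2"
    using h_vector_dead_node[OF d, of 2] coeff_minor_poly_levels[OF U, of 2] level_0[OF U] card_level_1[OF U]
    by (simp add: numeral_2_eq_2 rk c[unfolded numeral_2_eq_2])
  have h1: "h_vector (dead_node M B0 \<sigma>) 1 = int ?n - 2"
    using h_vector_dead_node_1[OF d] rk by simp
  have n: "?n \<ge> 2"
  proof -
    have "0 \<le> h_vector (dead_node M B0 \<sigma>) 1"
      using h_vector_dead_node[OF d, of 1] coeff_minor_poly_nonneg[OF finite_A U(2)] by simp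
    then show ?thesis using h1 by simp
  qed
  then obtain p where p: "?n = p + 2" by (metis add.commute le_iff_add)
  have "int ?f2 \<le> int ((p + 2) choose 2)" using card_level_2_le[OF U(1) finite_A[of \<sigma>]] p by simp
  moreover have "(p + 2) choose 2 = ((p + 1) choose 2) + (p + 1)"
    by (simp add: numeral_2_eq_2)
  ultimately show ?thesis unfolding h2 h1 p by simp
qed

lemma h_vector_dead_node_nonneg: "dead M B0 \<sigma> \<Longrightarrow> 0 \<le> h_vector (dead_node M B0 \<sigma>) k"
  using h_vector_dead_node[of \<sigma> k] coeff_minor_poly_nonneg[OF finite_A] U_subset_A by (simp add: dead_iff)

lemma h_vector_dead_node_above:
  "dead M B0 \<sigma> \<Longrightarrow> rank_of M (A \<sigma>) - card (U \<sigma>) < k \<Longrightarrow> h_vector (dead_node M B0 \<sigma>) k = 0"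
  by (simp add: h_vector_def rank_dead_node)

lemma card_A_minus_U: "dead M B0 \<sigma> \<Longrightarrow> card (A \<sigma> - U \<sigma>) = rank_of M (A \<sigma>) - card (U \<sigma>) + card \<sigma>"
  using card_A[of \<sigma>] card_U_le_rank_A[of \<sigma>] U_subset_A[of \<sigma>] finite_U[of \<sigma>]
  by (simp add: dead_iff card_Diff_subset)

lemma A_minus_U_subset_B0: "\<sigma> \<subseteq> R \<Longrightarrow> A \<sigma> - U \<sigma> \<subseteq> B0"
  using A_minus_stratum[of \<sigma>] stratum_subset_U[of \<sigma>] by blast

end


section \<open>Assembling fibres stratum by stratum\<close>

context matroid_with_basis
begin

lemma zero_in_fibre:
  assumes "dead M B0 \<tau>" "fibre_shape M B0 \<tau> S"
  shows "(\<lambda>i. 0) \<in> S"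
proof -
  have "degree_sequence \<tau> S 0 = 1"
    using fibre_shape_props(5)[OF assms(2)] h_vector_dead_node_0[OF assms(1)] by simp
  then have "{a \<in> S. sum a \<tau> = 0} \<noteq> {}" by (intro notI) (simp add: degree_sequence_def)
  then obtain a where "a \<in> S" by blast
  then show ?thesis by (rule fibre_shape_props(3)[OF assms(2)]) (simp add: le_fun_def)
qed

lemma obeys_if_baseline:
  assumes "dead M B0 \<tau>" "fibre_shape M B0 \<tau> (F \<tau>)" "\<And>i. i \<in> \<tau> \<Longrightarrow> a i = b \<tau> i"
  shows "obeys F \<tau> a"
proof -
  have "(\<lambda>i. vec_restrict a \<tau> i - b \<tau> i) = (\<lambda>i. 0)"
    using assms(3) by (auto simp: vec_restrict_def)
  then show ?thesis using zero_in_fibre[OF assms(1,2)] assms(1) by (simp add: obeys_def)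
qed

text \<open>The baselines of \<open>\<tau>\<close> are at least those of \<open>\<sigma>\<close>. If they do not exceed them, they coincide,
  and then every element of \<open>U \<tau>\<close> is already in \<open>U \<sigma>\<close>.\<close>

lemma fired_at_baseline:
  assumes d: "dead M B0 \<sigma>" and \<tau>: "stratum M B0 \<tau>" "\<tau> \<subseteq> \<sigma>" "\<And>i. i \<in> \<tau> \<Longrightarrow> b \<tau> i \<le> b \<sigma> i"
  shows "dead M B0 \<tau>" "\<And>i. i \<in> \<tau> \<Longrightarrow> b \<sigma> i = b \<tau> i"
proof -
  have s: "\<sigma> \<subseteq> R" and t: "\<tau> \<subseteq> R" using d \<tau> by (auto simp: dead_iff stratum_iff)
  show eq: "b \<sigma> i = b \<tau> i" if "i \<in> \<tau>" for i
    using \<tau>(3)[OF that] baseline_antimono[OF that \<tau>(2) s] by simp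
  have "C i \<inter> U \<tau> = C i \<inter> U \<sigma>" if "i \<in> \<tau>" for i
    using eq[OF that] that \<tau>(2) private_antimono[OF that \<tau>(2) s] finite_U
    by (intro card_seteq[symmetric]) (auto simp: baseline_def)
  then have "U \<tau> \<subseteq> U \<sigma>" using U_eq_Union[OF t] by blast
  then have "indep M (U \<tau>)" using d indep_mono by (auto simp: dead_iff)
  then show "dead M B0 \<tau>" using \<tau>(1) by (simp add: dead_def)
qed

lemma unconditional_imp_fibre:
  assumes "unconditional_fibre M B0 \<sigma> S"
    and F: "\<And>\<tau>. dead M B0 \<tau> \<Longrightarrow> \<tau> \<subset> \<sigma> \<Longrightarrow> fibre M B0 F \<tau> (F \<tau>)"
  shows "fibre M B0 F \<sigma> S"
  unfolding fibre_iff
proof (intro conjI ballI allI impI)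
  show "dead M B0 \<sigma>" "fibre_shape M B0 \<sigma> S" using assms(1) by (auto simp: unconditional_fibre_def)
  fix m \<tau> assume m: "m \<in> S" and \<tau>: "stratum M B0 \<tau> \<and> \<tau> \<subset> \<sigma> \<and> can_be_fired M B0 \<tau> (\<lambda>i. b \<sigma> i + m i)"
  then have d: "dead M B0 \<tau>" "vec_restrict (\<lambda>i. b \<sigma> i + m i) \<tau> = b \<tau>"
    using assms(1) by (auto simp: unconditional_fibre_def Let_def)
  have "fibre_shape M B0 \<tau> (F \<tau>)" using F d(1) \<tau> by (simp add: fibre_iff)
  then have "(\<lambda>i. 0) \<in> F \<tau>" by (rule zero_in_fibre[OF d(1)])
  then show "obeys F \<tau> (\<lambda>i. b \<sigma> i + m i)" using d by (simp add: obeys_def)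
qed

lemma fibre_cong:
  assumes "\<And>\<tau>. \<tau> \<subset> \<sigma> \<Longrightarrow> F \<tau> = G \<tau>"
  shows "fibre M B0 F \<sigma> S \<longleftrightarrow> fibre M B0 G \<sigma> S"
  unfolding fibre_def Let_def using assms by (intro conj_cong refl ball_cong all_cong1) auto

text \<open>A fibre at \<open>\<sigma>\<close> depends only on the fibres strictly inside \<open>\<sigma>\<close>, so fibres can be chosen in
  order of size.\<close>

lemma fibre_systemI:
  assumes step: "\<And>\<sigma> F. dead M B0 \<sigma> \<Longrightarrow> (\<And>\<tau>. dead M B0 \<tau> \<Longrightarrow> \<tau> \<subset> \<sigma> \<Longrightarrow> fibre M B0 F \<tau> (F \<tau>)) \<Longrightarrow>
      \<exists>S. fibre M B0 F \<sigma> S"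
  shows "\<exists>F. fibre_system M B0 F"
proof -
  have "\<exists>F. \<forall>\<sigma>. dead M B0 \<sigma> \<and> card \<sigma> < n \<longrightarrow> fibre M B0 F \<sigma> (F \<sigma>)" for n
  proof (induction n)
    case (Suc n)
    then obtain F where F: "\<And>\<sigma>. dead M B0 \<sigma> \<Longrightarrow> card \<sigma> < n \<Longrightarrow> fibre M B0 F \<sigma> (F \<sigma>)" by blast
    define G where "G \<sigma> = (if card \<sigma> < n then F \<sigma> else SOME S. fibre M B0 F \<sigma> S)" for \<sigma>
    have "fibre M B0 G \<sigma> (G \<sigma>)" if \<sigma>: "dead M B0 \<sigma>" "card \<sigma> < Suc n" for \<sigma>
    proof -
      have small: "card \<tau> < n" if "\<tau> \<subset> \<sigma>" for \<tau>
        using psubset_card_mono[OF _ that] \<sigma> finite_stratum[of \<sigma>] by (simp add: dead_iff)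
      have FG: "fibre M B0 G \<sigma> S \<longleftrightarrow> fibre M B0 F \<sigma> S" for S
        using small by (intro fibre_cong) (simp add: G_def)
      have "fibre M B0 F \<sigma> (G \<sigma>)"
      proof (cases "card \<sigma> < n")
        case False
        have "\<exists>S. fibre M B0 F \<sigma> S"
          by (rule step[OF \<sigma>(1)]) (rule F[OF _ small])
        then show ?thesis using False by (simp add: G_def someI_ex)
      qed (use F \<sigma>(1) in \<open>simp add: G_def\<close>)
      then show ?thesis by (simp add: FG)
    qed
    then show ?case by (intro exI[of _ G] allI impI) simp
  qed simp
  from this[of "Suc (card R)"] obtain F where
    F: "\<And>\<sigma>. dead M B0 \<sigma> \<Longrightarrow> card \<sigma> < Suc (card R) \<Longrightarrow> fibre M B0 F \<sigma> (F \<sigma>)" by blast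
  have "fibre M B0 F \<sigma> (F \<sigma>)" if "dead M B0 \<sigma>" for \<sigma>
    using F[OF that] that card_mono[OF finite_R, of \<sigma>] by (simp add: dead_iff less_Suc_eq_le)
  then show ?thesis unfolding fibre_system_def by (intro exI[of _ F]) simp
qed

text \<open>At the zero vector compatibility comes for free, from \<open>fired_at_baseline\<close>.\<close>

lemma fibreI:
  assumes d: "dead M B0 \<sigma>" and F: "\<And>\<tau>. dead M B0 \<tau> \<Longrightarrow> \<tau> \<subset> \<sigma> \<Longrightarrow> fibre M B0 F \<tau> (F \<tau>)"
    and sh: "fibre_shape M B0 \<sigma> S"
    and pos: "\<And>m \<tau>. m \<in> S \<Longrightarrow> m \<noteq> (\<lambda>i. 0) \<Longrightarrow> stratum M B0 \<tau> \<Longrightarrow> \<tau> \<subset> \<sigma> \<Longrightarrow>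
      can_be_fired M B0 \<tau> (\<lambda>i. b \<sigma> i + m i) \<Longrightarrow> obeys F \<tau> (\<lambda>i. b \<sigma> i + m i)"
  shows "fibre M B0 F \<sigma> S"
  unfolding fibre_iff
proof (intro conjI ballI allI impI d sh)
  fix m \<tau> assume m: "m \<in> S" and \<tau>: "stratum M B0 \<tau> \<and> \<tau> \<subset> \<sigma> \<and> can_be_fired M B0 \<tau> (\<lambda>i. b \<sigma> i + m i)"
  show "obeys F \<tau> (\<lambda>i. b \<sigma> i + m i)"
  proof (cases "m = (\<lambda>i. 0)")
    case True
    then have le: "\<And>i. i \<in> \<tau> \<Longrightarrow> b \<tau> i \<le> b \<sigma> i" and \<tau>': "stratum M B0 \<tau>" "\<tau> \<subseteq> \<sigma>"
      using \<tau> by (auto simp: can_be_fired_def)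
    note * = fired_at_baseline[OF d \<tau>' le]
    have "fibre_shape M B0 \<tau> (F \<tau>)" using F[of \<tau>] *(1) \<tau> by (simp add: fibre_iff)
    then show ?thesis using *(2) True by (intro obeys_if_baseline[OF *(1)]) auto
  qed (use pos m \<tau> in blast)
qed

end


section \<open>Multicomplexes of low degree\<close>

definition unit_vec :: "'v \<Rightarrow> 'v \<Rightarrow> nat" where
  "unit_vec i = (\<lambda>j. if j = i then 1 else 0)"

lemma le_unit_vec: "c \<le> unit_vec i \<Longrightarrow> c = (\<lambda>j. 0) \<or> c = unit_vec i"
proof -
  assume c: "c \<le> unit_vec i"
  have 0: "c j = 0" if "j \<noteq> i" for j using le_funD[OF c, of j] that by (simp add: unit_vec_def)
  have "c i = 0 \<or> c i = 1" using le_funD[OF c, of i] by (auto simp: unit_vec_def)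
  then show ?thesis
  proof
    assume "c i = 0"
    then have "c j = 0" for j using 0[of j] by (cases "j = i") auto
    then show ?thesis by auto
  next
    assume "c i = 1"
    then have "c j = unit_vec i j" for j using 0[of j] by (cases "j = i") (auto simp: unit_vec_def)
    then show ?thesis by auto
  qed
qed

lemma sum_unit_vec: "finite V \<Longrightarrow> i \<in> V \<Longrightarrow> sum (unit_vec i) V = 1"
  by (simp add: unit_vec_def)

lemma inj_unit_vec: "inj_on unit_vec I"
  by (rule inj_onI) (metis unit_vec_def zero_neq_one)

lemma
  assumes V: "finite V" and I: "I \<subseteq> V"
  defines "S \<equiv> insert (\<lambda>j. 0) (unit_vec ` I)"
  shows pure_multicomplex_linear: "pure_multicomplex V S"
    and degree_sequence_linear: "degree_sequence V S k = (if k = 0 then 1 else if k = 1 then int (card I) else 0)"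
proof -
  have deg: "sum (unit_vec i) V = 1" if "i \<in> I" for i using that I by (intro sum_unit_vec V) auto
  have mc: "multicomplex V S"
    unfolding multicomplex_def
  proof (intro conjI ballI allI impI)
    show "finite S" using V I finite_subset by (auto simp: S_def)
    show "S \<subseteq> monomials V" using I by (auto simp: S_def monomials_def unit_vec_def)
    fix a c assume "a \<in> S" "c \<le> a"
    then show "c \<in> S" using le_unit_vec[of c] by (auto simp: S_def le_fun_def)
  qed
  show "pure_multicomplex V S"
  proof (cases "I = {}")
    case True
    then show ?thesis by (intro pure_multicomplexI[OF mc, of 0]) (auto simp: S_def)
  next
    case False
    then obtain i where "i \<in> I" by blast
    then show ?thesis using deg
      by (intro pure_multicomplexI[OF mc, of 1]) (auto simp: S_def le_fun_def)
  qed
  have "{a \<in> S. sum a V = k} = (if k = 0 then {\<lambda>j. 0} else if k = 1 then unit_vec ` I else {})"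
    using deg by (auto simp: S_def)
  then show "degree_sequence V S k = (if k = 0 then 1 else if k = 1 then int (card I) else 0)"
    by (simp add: degree_sequence_def card_image[OF inj_unit_vec])
qed

definition two_var :: "'v \<Rightarrow> 'v \<Rightarrow> nat \<times> nat \<Rightarrow> 'v \<Rightarrow> nat" where
  "two_var i j = (\<lambda>(p, q) k. if k = i then p else if k = j then q else 0)"

lemma
  assumes ij: "i \<noteq> j" and T: "finite T"
    and down: "\<And>p q p' q'. (p, q) \<in> T \<Longrightarrow> p' \<le> p \<Longrightarrow> q' \<le> q \<Longrightarrow> (p', q') \<in> T"
    and up: "\<And>p q. (p, q) \<in> T \<Longrightarrow> \<exists>p' q'. (p', q') \<in> T \<and> p \<le> p' \<and> q \<le> q' \<and> p' + q' = d"
  shows pure_multicomplex_two_var: "pure_multicomplex {i, j} (two_var i j ` T)"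
    and degree_sequence_two_var:
      "degree_sequence {i, j} (two_var i j ` T) k = (\<Sum>x\<in>T. if fst x + snd x = k then 1 else 0)"
proof -
  have val: "two_var i j (p, q) i = p" "two_var i j (p, q) j = q" "l \<noteq> i \<Longrightarrow> l \<noteq> j \<Longrightarrow> two_var i j (p, q) l = 0"
    for p q l using ij by (auto simp: two_var_def)
  have deg: "sum (two_var i j x) {i, j} = fst x + snd x" for x
    using ij by (cases x) (simp add: val)
  have eqI: "c = two_var i j (c i, c j)" if "\<And>l. l \<noteq> i \<Longrightarrow> l \<noteq> j \<Longrightarrow> c l = 0" for c
    using that by (auto simp: two_var_def fun_eq_iff)
  have mc: "multicomplex {i, j} (two_var i j ` T)"
    unfolding multicomplex_def
  proof (intro conjI ballI allI impI)
    show "two_var i j ` T \<subseteq> monomials {i, j}" by (auto simp: monomials_def two_var_def)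
    fix a c assume "a \<in> two_var i j ` T" and c: "c \<le> a"
    then obtain p q where pq: "(p, q) \<in> T" "a = two_var i j (p, q)" by auto
    have "c i \<le> p" "c j \<le> q" using le_funD[OF c, of i] le_funD[OF c, of j] pq(2) by (simp_all add: val)
    then have "(c i, c j) \<in> T" using down[OF pq(1)] by simp
    moreover have "c l = 0" if "l \<noteq> i" "l \<noteq> j" for l
      using le_funD[OF c, of l] that pq(2) by (simp add: val)
    ultimately show "c \<in> two_var i j ` T" using eqI[of c] by blast
  qed (use T in simp)
  show "pure_multicomplex {i, j} (two_var i j ` T)"
  proof (rule pure_multicomplexI[OF mc, of d])
    fix a assume "a \<in> two_var i j ` T"
    then obtain p q where pq: "(p, q) \<in> T" "a = two_var i j (p, q)" by auto
    obtain p' q' where *: "(p', q') \<in> T" "p \<le> p'" "q \<le> q'" "p' + q' = d" using up[OF pq(1)] by blast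
    have "a \<le> two_var i j (p', q')" using * by (auto simp: pq(2) two_var_def le_fun_def)
    then show "\<exists>c\<in>two_var i j ` T. a \<le> c \<and> sum c {i, j} = d"
      using * deg[of "(p', q')"] by (intro bexI[of _ "two_var i j (p', q')"]) auto
  qed
  have inj: "inj_on (two_var i j) T"
    by (rule inj_onI) (metis surj_pair val(1,2))
  have "{a \<in> two_var i j ` T. sum a {i, j} = k} = two_var i j ` {x \<in> T. fst x + snd x = k}"
    using deg by auto
  then have "card {a \<in> two_var i j ` T. sum a {i, j} = k} = card {x \<in> T. fst x + snd x = k}"
    using card_image[OF inj_on_subset[OF inj, of "{x \<in> T. fst x + snd x = k}"]] by simp
  then show "degree_sequence {i, j} (two_var i j ` T) k = (\<Sum>x\<in>T. if fst x + snd x = k then 1 else 0)"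
    using T by (simp add: degree_sequence_def sum.If_cases Int_def)
qed

text \<open>In degree at most two with at most two variables, every sequence within Macaulay's bound
  is a pure O-sequence. There are seven of them, realised one by one.\<close>

lemma two_variable_pure_O_sequence:
  fixes h :: "nat \<Rightarrow> int"
  assumes ij: "i \<noteq> j" and h: "h 0 = 1" "0 \<le> h 1" "h 1 \<le> 2" "0 \<le> h 2"
    "h 2 \<le> int ((nat (h 1) + 1) choose 2)" "\<And>k. 2 < k \<Longrightarrow> h k = 0"
  shows "\<exists>S. pure_multicomplex {i, j} S \<and> degree_sequence {i, j} S = h"
proof -
  have cover: "\<exists>S. pure_multicomplex {i, j} S \<and> degree_sequence {i, j} S = h"
    if "finite T" "\<forall>(p, q)\<in>T. \<forall>p'\<le>p. \<forall>q'\<le>q. (p', q') \<in> T"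
      "\<forall>(p, q)\<in>T. \<exists>(p', q')\<in>T. p \<le> p' \<and> q \<le> q' \<and> p' + q' = d"
      "\<And>x. x \<in> T \<Longrightarrow> fst x + snd x \<le> 2"
      "(\<Sum>x\<in>T. if fst x + snd x = 0 then 1 else 0) = h 0"
      "(\<Sum>x\<in>T. if fst x + snd x = 1 then 1 else 0) = h 1"
      "(\<Sum>x\<in>T. if fst x + snd x = 2 then 1 else 0) = h 2" for T :: "(nat \<times> nat) set" and d
  proof (intro exI conjI ext)
    have down: "(p', q') \<in> T" if "(p, q) \<in> T" "p' \<le> p" "q' \<le> q" for p q p' q'
      using \<open>\<forall>(p, q)\<in>T. \<forall>p'\<le>p. \<forall>q'\<le>q. (p', q') \<in> T\<close> that by blast
    have up: "\<exists>p' q'. (p', q') \<in> T \<and> p \<le> p' \<and> q \<le> q' \<and> p' + q' = d" if "(p, q) \<in> T" for p q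
      using \<open>\<forall>(p, q)\<in>T. \<exists>(p', q')\<in>T. p \<le> p' \<and> q \<le> q' \<and> p' + q' = d\<close> that by blast
    show "pure_multicomplex {i, j} (two_var i j ` T)"
      by (rule pure_multicomplex_two_var[OF ij that(1) down up])
    fix k
    have deg: "degree_sequence {i, j} (two_var i j ` T) k = (\<Sum>x\<in>T. if fst x + snd x = k then 1 else 0)"
      by (rule degree_sequence_two_var[OF ij that(1) down up])
    consider "k = 0" | "k = 1" | "k = 2" | "2 < k" by linarith
    then show "degree_sequence {i, j} (two_var i j ` T) k = h k"
    proof cases
      case 4
      then have "(\<Sum>x\<in>T. if fst x + snd x = k then 1 else 0) = (0 :: int)"
        using that(4) by (intro sum.neutral) force
      then show ?thesis using deg h(6)[OF 4] by simp
    qed (use deg that(5-7) in simp_all)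
  qed
  have "h 1 = 0 \<or> h 1 = 1 \<or> h 1 = 2" using h by linarith
  then consider "h 1 = 0" "h 2 = 0" | "h 1 = 1" "h 2 = 0" | "h 1 = 1" "h 2 = 1"
    | "h 1 = 2" "h 2 = 0" | "h 1 = 2" "h 2 = 1" | "h 1 = 2" "h 2 = 2" | "h 1 = 2" "h 2 = 3"
    using h(4,5) by (auto simp: numeral_2_eq_2) linarith+
  then show ?thesis
  proof cases
    case 1 then show ?thesis using h(1) by (intro cover[of "{(0, 0)}" 0]) auto
  next
    case 2 then show ?thesis using h(1)
      by (intro cover[of "{(0, 0), (1, 0)}" 1]) (auto simp: le_Suc_eq numeral_2_eq_2)
  next
    case 3 then show ?thesis using h(1)
      by (intro cover[of "{(0, 0), (1, 0), (2, 0)}" 2]) (auto simp: le_Suc_eq numeral_2_eq_2)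
  next
    case 4 then show ?thesis using h(1)
      by (intro cover[of "{(0, 0), (1, 0), (0, 1)}" 1]) (auto simp: le_Suc_eq numeral_2_eq_2)
  next
    case 5 then show ?thesis using h(1)
      by (intro cover[of "{(0, 0), (1, 0), (0, 1), (1, 1)}" 2]) (auto simp: le_Suc_eq numeral_2_eq_2)
  next
    case 6 then show ?thesis using h(1)
      by (intro cover[of "{(0, 0), (1, 0), (0, 1), (1, 1), (2, 0)}" 2]) (auto simp: le_Suc_eq numeral_2_eq_2)
  next
    case 7 then show ?thesis using h(1)
      by (intro cover[of "{(0, 0), (1, 0), (0, 1), (1, 1), (2, 0), (0, 2)}" 2]) (auto simp: le_Suc_eq numeral_2_eq_2)
  qed
qed


section \<open>Dead pairs and dead triples in rank at most four\<close>

context matroid_with_basis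
begin

lemma fibre_rank_zero:
  assumes d: "dead M B0 \<sigma>" and rk: "rank_of M (A \<sigma>) \<le> card (U \<sigma>)"
    and F: "\<And>\<tau>. dead M B0 \<tau> \<Longrightarrow> \<tau> \<subset> \<sigma> \<Longrightarrow> fibre M B0 F \<tau> (F \<tau>)"
  shows "fibre M B0 F \<sigma> {\<lambda>i. 0}"
proof (rule fibreI[OF d F])
  have fin: "finite \<sigma>" using d finite_stratum by (simp add: dead_iff)
  show "fibre_shape M B0 \<sigma> {\<lambda>i. 0}"
    unfolding fibre_shape_def
  proof (intro conjI ext)
    show "pure_multicomplex \<sigma> {\<lambda>i. 0}" using pure_multicomplex_linear[OF fin, of "{}"] by simp
    fix k show "degree_sequence \<sigma> {\<lambda>i. 0} k = h_vector (dead_node M B0 \<sigma>) k"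
      using degree_sequence_linear[OF fin, of "{}" k] h_vector_dead_node_0[OF d]
        h_vector_dead_node_above[OF d, of k] rk by (cases "k = 0") auto
  qed
qed auto

lemma A_minus_U_two:
  assumes "\<sigma> \<subseteq> R" "e \<in> A \<sigma> - U \<sigma>" "i \<in> \<sigma>"
  shows "\<exists>j\<in>\<sigma>. j \<noteq> i \<and> e \<in> C j"
proof -
  obtain j where j: "j \<in> \<sigma>" "e \<in> C j" using assms(2) unfolding Diff_iff in_A_iff[OF assms(1)] by blast
  show ?thesis
  proof (cases "j = i")
    case True
    have "\<not> (\<forall>k\<in>\<sigma>. e \<in> C k \<longrightarrow> k = j)"
      using assms(2) j unfolding Diff_iff in_U_iff[OF assms(1)] by blast
    then show ?thesis using True by blast
  qed (use j in blast)
qed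

text \<open>Let \<open>r\<close> be the rank of the dead node; its ground set has \<open>r + 2\<close> elements, and they lie on
  both circuits. So \<open>C k\<close> has \<open>r + 2\<close> elements more than the baseline at \<open>k\<close>, and firing \<open>{k}\<close>
  would take a monomial of degree at least \<open>r + 2\<close>, whereas the fibre stops at degree \<open>r\<close>.\<close>

theorem dead_pair_unconditional_fibre:
  assumes d: "dead M B0 \<sigma>" and two: "card \<sigma> = 2" and rk: "rank M \<le> 4"
  shows "\<exists>S. unconditional_fibre M B0 \<sigma> S"
proof -
  let ?h = "h_vector (dead_node M B0 \<sigma>)"
  define r where "r = rank_of M (A \<sigma>) - card (U \<sigma>)"
  have s: "\<sigma> \<subseteq> R" using d by (simp add: dead_iff)
  obtain i j where ij: "\<sigma> = {i, j}" "i \<noteq> j" using two by (auto simp: card_2_iff)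
  have Q: "card (A \<sigma> - U \<sigma>) = r + 2" using card_A_minus_U[OF d] two by (simp add: r_def)
  have r: "r \<le> 2"
    using card_mono[OF finite_B0 A_minus_U_subset_B0[OF s]] Q card_B0 rk by simp
  \<comment> \<open>The dead node has at most \<open>r + 2\<close> non-loops.\<close>
  have h1: "?h 1 \<le> 2"
  proof -
    have "card {x \<in> A \<sigma> - U \<sigma>. indep M (insert x (U \<sigma>))} \<le> r + 2"
      unfolding Q[symmetric] using finite_A by (intro card_mono) auto
    then show ?thesis using h_vector_dead_node_1[OF d] by (simp add: r_def)
  qed
  have h2: "?h 2 \<le> int ((nat (?h 1) + 1) choose 2)"
  proof (cases "r = 2")
    case True
    then show ?thesis by (intro h_vector_dead_node_2_le[OF d]) (simp add: r_def)
  next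
    case False
    then show ?thesis using h_vector_dead_node_above[OF d, of 2] r by (simp add: r_def)
  qed
  obtain S where S: "pure_multicomplex \<sigma> S" "degree_sequence \<sigma> S = ?h"
  proof -
    have "\<exists>S. pure_multicomplex {i, j} S \<and> degree_sequence {i, j} S = ?h"
      using h_vector_dead_node_above[OF d] r
      by (intro two_variable_pure_O_sequence[OF ij(2)] h_vector_dead_node_0[OF d] h_vector_dead_node_nonneg[OF d] h1 h2)
        (simp add: r_def)
    then show ?thesis using that ij(1) by blast
  qed
  have sh: "fibre_shape M B0 \<sigma> S" using S by (simp add: fibre_shape_def)
  have no_fire: "\<not> can_be_fired M B0 \<tau> (\<lambda>i. b \<sigma> i + m i)"
    if m: "m \<in> S" and \<tau>: "stratum M B0 \<tau>" "\<tau> \<subset> \<sigma>" for m \<tau>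
  proof
    assume f: "can_be_fired M B0 \<tau> (\<lambda>i. b \<sigma> i + m i)"
    obtain k where k: "\<tau> = {k}" "k \<in> \<sigma>"
      using \<tau> ij by (auto simp: stratum_iff)
    have kR: "k \<in> R" using k s by blast
    \<comment> \<open>An element covered twice by two circuits lies on both.\<close>
    have "A \<sigma> - U \<sigma> \<subseteq> C k"
    proof
      fix e assume e: "e \<in> A \<sigma> - U \<sigma>"
      have "(if k = i then j else i) \<in> \<sigma>" using ij by simp
      from A_minus_U_two[OF s e this] show "e \<in> C k" using k(2) unfolding ij(1) by (auto split: if_splits)
    qed
    then have "card (C k) = card (C k \<inter> U \<sigma>) + card (A \<sigma> - U \<sigma>)"
      using C_subset_A[OF k(2) s] finite_C[OF kR] finite_A[of \<sigma>]
      by (subst card_Un_disjoint[symmetric]) (auto intro: arg_cong[where f = card])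
    moreover have "card (C k) \<le> b \<sigma> k + m k"
      using f k by (simp add: can_be_fired_def baseline_singleton[OF kR])
    ultimately have "r + 2 \<le> m k" using k(2) Q by (simp add: baseline_def)
    moreover have "m k \<le> sum m \<sigma>" using k(2) finite_stratum[OF s] by (intro member_le_sum) auto
    moreover have "sum m \<sigma> \<le> r"
    proof (rule ccontr)
      assume "\<not> sum m \<sigma> \<le> r"
      then have "degree_sequence \<sigma> S (sum m \<sigma>) = 0"
        using h_vector_dead_node_above[OF d] by (simp add: S(2) r_def)
      moreover have "finite {a \<in> S. sum a \<sigma> = sum m \<sigma>}" using fibre_shape_props(2)[OF sh] by simp
      ultimately show False using m by (auto simp: degree_sequence_def)
    qed
    ultimately show False by simp
  qed
  then have "unconditional_fibre M B0 \<sigma> S"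
    unfolding unconditional_fibre_def Let_def using d sh by blast
  then show ?thesis by blast
qed

end

text \<open>The case of a dead triple that is not settled by the zero vector: the dead node has rank
  one and ground set \<open>B0\<close>, every element of which lies on at least two of the three circuits.\<close>

locale dead_triple = matroid_with_basis +
  fixes \<sigma> :: "'a set" and F :: "'a set \<Rightarrow> ('a \<Rightarrow> nat) set"
  assumes dead: "dead M B0 \<sigma>" and card3: "card \<sigma> = 3"
    and B0_4: "card B0 = 4"
    and full: "A \<sigma> - U \<sigma> = B0"
    and inner: "dead M B0 \<tau> \<Longrightarrow> \<tau> \<subset> \<sigma> \<Longrightarrow> fibre M B0 F \<tau> (F \<tau>)"
begin

lemma \<sigma>_subset_R: "\<sigma> \<subseteq> R"
  using dead by (simp add: dead_iff)

lemma finite_\<sigma>: "finite \<sigma>"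
  using finite_stratum[OF \<sigma>_subset_R] .

lemma U_eq: "U \<sigma> = \<sigma>"
proof
  show "U \<sigma> \<subseteq> \<sigma>" using U_subset_A[OF \<sigma>_subset_R] A_minus_stratum[OF \<sigma>_subset_R] full by blast
qed (rule stratum_subset_U[OF \<sigma>_subset_R])

lemma indep_\<sigma>: "indep M \<sigma>"
  using dead by (simp add: dead_iff U_eq)

lemma rank_A_\<sigma>: "rank_of M (A \<sigma>) = 4"
  using rank_A[OF \<sigma>_subset_R] full B0_4 by (metis Diff_subset inf.absorb2)

lemma baseline_\<sigma>: "i \<in> \<sigma> \<Longrightarrow> b \<sigma> i = 1"
proof -
  assume i: "i \<in> \<sigma>"
  have "C i \<inter> \<sigma> = {i}" using in_C_R[of i] self_in_C[of i] i \<sigma>_subset_R by auto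
  then show ?thesis using i by (simp add: baseline_def U_eq)
qed

lemma covered_twice:
  assumes "i \<in> \<sigma>" "j \<in> \<sigma>" "i \<noteq> j" "x \<in> B0"
  shows "x \<in> C i \<or> x \<in> C j"
proof (rule ccontr)
  assume no: "\<not> ?thesis"
  have "card (\<sigma> - {i, j}) = 1" using assms card3 finite_\<sigma> by (simp add: card_Diff_subset)
  then obtain k where k: "\<sigma> - {i, j} = {k}" by (auto simp: card_1_singleton_iff)
  have "x \<in> A \<sigma> - U \<sigma>" using full assms by simp
  moreover have "k \<in> \<sigma>" using k by auto
  ultimately obtain l where "l \<in> \<sigma>" "l \<noteq> k" "x \<in> C l" using A_minus_U_two[OF \<sigma>_subset_R] by blast
  then show False using k no by blast
qed

lemma C_not_in_singleton: "i \<in> \<sigma> \<Longrightarrow> \<not> C i \<subseteq> {i}"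
proof
  assume i: "i \<in> \<sigma>" "C i \<subseteq> {i}"
  then have "C i \<subseteq> \<sigma>" "i \<in> R" using \<sigma>_subset_R by auto
  then show False using circuit_not_subset_indep[OF fundamental_circuit_props(1) indep_\<sigma>] by blast
qed

text \<open>A dependent pair \<open>{i, x}\<close> with \<open>x \<in> B0\<close> contains a circuit inside \<open>insert i B0\<close>, and there
  is only one.\<close>

lemma parallel_pair:
  assumes i: "i \<in> \<sigma>" and x: "x \<in> B0" and dep: "\<not> indep M {i, x}"
  shows "C i = {i, x}"
proof -
  have iR: "i \<in> R" using i \<sigma>_subset_R by blast
  have "{i, x} \<subseteq> ground M" using iR x B0_subset by blast
  then obtain D where D: "circuit M D" "D \<subseteq> {i, x}" using dependent_contains_circuit dep by blast
  have "D = C i" using D x by (intro fundamental_circuit_eqI[OF iR]) auto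
  then show ?thesis using D(2) C_not_in_singleton[OF i] self_in_C[OF iR] by blast
qed

lemma circuit_triple:
  assumes ij: "i \<in> \<sigma>" "j \<in> \<sigma>" "x \<in> B0"
    and pairs: "indep M {i, x}" "indep M {j, x}" and dep: "\<not> indep M {x, i, j}"
  shows "circuit M {x, i, j}"
  unfolding circuit_def
proof (intro conjI allI impI dep)
  show "{x, i, j} \<subseteq> ground M" using ij \<sigma>_subset_R B0_subset by blast
  have ij_indep: "indep M {i, j}" using ij by (intro indep_mono[OF indep_\<sigma>]) auto
  fix D assume "D \<subset> {x, i, j}"
  then have "D \<subseteq> {i, x} \<or> D \<subseteq> {j, x} \<or> D \<subseteq> {i, j}" by auto
  then show "indep M D" using pairs ij_indep indep_mono by metis
qed

text \<open>The sets \<open>missing i\<close> for \<open>i \<in> \<sigma>\<close> are pairwise disjoint and determine the baselines of the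
  pairs: the private part of \<open>C i\<close> in the pair \<open>{i, j}\<close> is \<open>i\<close> together with \<open>missing j\<close>.\<close>

definition missing where "missing i = B0 - C i"

lemma missing_disjoint: "i \<in> \<sigma> \<Longrightarrow> j \<in> \<sigma> \<Longrightarrow> i \<noteq> j \<Longrightarrow> missing i \<subseteq> C j"
  using covered_twice[of i j] by (auto simp: missing_def)

lemma private_pair:
  assumes "i \<in> \<sigma>" "j \<in> \<sigma>" "i \<noteq> j"
  shows "C i \<inter> U {i, j} = insert i (missing j)"
proof -
  have iR: "i \<in> R" "j \<in> R" "{i, j} \<subseteq> R" using assms \<sigma>_subset_R by auto
  have "x \<in> C i \<inter> U {i, j} \<longleftrightarrow> x \<in> C i \<and> x \<notin> C j" for x
    unfolding Int_iff in_U_iff[OF iR(3)] using assms(3) by auto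
  moreover have "x \<in> C i \<and> x \<notin> C j \<longleftrightarrow> x \<in> insert i (missing j)" for x
  proof
    assume x: "x \<in> C i \<and> x \<notin> C j"
    then show "x \<in> insert i (missing j)"
      using fundamental_circuit_props(2)[OF iR(1)] by (auto simp: missing_def)
  next
    assume x: "x \<in> insert i (missing j)"
    have "i \<notin> C j" using in_C_R[OF iR(2,1)] assms(3) by auto
    then show "x \<in> C i \<and> x \<notin> C j"
      using x self_in_C[OF iR(1)] missing_disjoint[of j i] assms by (auto simp: missing_def)
  qed
  ultimately show ?thesis by blast
qed

lemma baseline_pair:
  assumes "i \<in> \<sigma>" "j \<in> \<sigma>" "i \<noteq> j"
  shows "b {i, j} i = Suc (card (missing j))"
proof -
  have "i \<notin> missing j" using assms \<sigma>_subset_R by (auto simp: missing_def)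
  then show ?thesis using finite_B0 by (simp add: baseline_def private_pair[OF assms] missing_def)
qed

lemma U_pair:
  assumes "i \<in> \<sigma>" "j \<in> \<sigma>" "i \<noteq> j"
  shows "U {i, j} = {i, j} \<union> missing i \<union> missing j"
proof -
  have "{i, j} \<subseteq> R" using assms \<sigma>_subset_R by auto
  then have "U {i, j} = (C i \<inter> U {i, j}) \<union> (C j \<inter> U {j, i})"
    using U_eq_Union[of "{i, j}"] by (simp add: insert_commute)
  then show ?thesis using private_pair[OF assms] private_pair[OF assms(2,1)] assms(3) by auto
qed

text \<open>The \<open>k\<close> for which the unit vector at \<open>k\<close> must not be in the fibre, on account of \<open>\<tau>\<close>.\<close>

definition blocked :: "'a set \<Rightarrow> 'a set" where
  "blocked \<tau> = {k \<in> \<sigma>. can_be_fired M B0 \<tau> (\<lambda>i. b \<sigma> i + unit_vec k i) \<and>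
     \<not> obeys F \<tau> (\<lambda>i. b \<sigma> i + unit_vec k i)}"

text \<open>The \<open>x \<in> B0\<close> in the closure of the independent set \<open>\<sigma>\<close> whose fundamental circuit in
  \<open>insert x \<sigma>\<close> is \<open>insert x \<tau>\<close>; for different \<open>\<tau>\<close> they are different.\<close>

definition spanned :: "'a set \<Rightarrow> 'a set" where
  "spanned \<tau> = {x \<in> B0. circuit M (insert x \<tau>)}"

lemma finite_spanned: "finite (spanned \<tau>)"
  using finite_B0 by (simp add: spanned_def)

lemma fired_unit:
  "\<tau> \<subseteq> \<sigma> \<Longrightarrow> i \<in> \<tau> \<Longrightarrow> can_be_fired M B0 \<tau> (\<lambda>i. b \<sigma> i + unit_vec k i) \<Longrightarrow> b \<tau> i \<le> (if i = k then 2 else 1)"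
proof -
  assume *: "\<tau> \<subseteq> \<sigma>" "i \<in> \<tau>" "can_be_fired M B0 \<tau> (\<lambda>i. b \<sigma> i + unit_vec k i)"
  then have "b \<tau> i \<le> b \<sigma> i + unit_vec k i" by (simp add: can_be_fired_def)
  moreover have "b \<sigma> i = 1" using * baseline_\<sigma> by blast
  ultimately show ?thesis by (auto simp: unit_vec_def split: if_splits)
qed

text \<open>The live stratum \<open>{i}\<close> can be fired only with the help of the unit vector at \<open>i\<close>, and only
  if \<open>i\<close> is parallel to an element of \<open>B0\<close>, which is then spanned.\<close>

lemma blocked_singleton: "i \<in> \<sigma> \<Longrightarrow> card (blocked {i}) \<le> card (spanned {i})"
proof -
  assume i: "i \<in> \<sigma>"
  have iR: "i \<in> R" using i \<sigma>_subset_R by blast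
  \<comment> \<open>\<open>i\<close> is not a loop, as \<open>\<sigma>\<close> is independent.\<close>
  have big: "2 \<le> card (C i)"
  proof -
    have "{i} \<subset> C i" using C_not_in_singleton[OF i] self_in_C[OF iR] by blast
    then show ?thesis using psubset_card_mono[OF finite_C[OF iR], of "{i}"] by simp
  qed
  have *: "k = i \<and> card (C i) = 2" if "k \<in> blocked {i}" for k
    using fired_unit[of "{i}" i k] that i big by (auto simp: blocked_def baseline_singleton[OF iR] split: if_splits)
  show ?thesis
  proof (cases "blocked {i} = {}")
    case False
    then have "card (C i) = 2" using * by blast
    then have "card (C i - {i}) = 1" using self_in_C[OF iR] by simp
    then obtain x where "C i - {i} = {x}" by (auto simp: card_1_singleton_iff)
    then have x: "C i = {i, x}" "x \<noteq> i" using self_in_C[OF iR] by auto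
    then have "x \<in> spanned {i}"
      using fundamental_circuit_props[OF iR] by (auto simp: spanned_def insert_commute)
    then have "1 \<le> card (spanned {i})" using finite_spanned by (auto simp: Suc_le_eq card_gt_0_iff)
    moreover have "blocked {i} \<subseteq> {i}" using * by blast
    then have "card (blocked {i}) \<le> 1" using card_mono[of "{i}" "blocked {i}"] by simp
    ultimately show ?thesis by simp
  qed simp
qed

lemma indep_with_full_circuit:
  assumes "i \<in> \<sigma>" "missing i = {}" "x \<in> B0"
  shows "indep M {i, x}"
proof (rule ccontr)
  assume "\<not> indep M {i, x}"
  then have "C i = {i, x}" using parallel_pair assms by blast
  moreover have "i \<notin> B0" using assms(1) \<sigma>_subset_R by blast
  ultimately have "B0 \<subseteq> {x}" using assms(2) by (auto simp: missing_def)
  then show False using card_mono[of "{x}" B0] B0_4 by simp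
qed

text \<open>If \<open>missing j\<close> is nonempty, the baseline of \<open>{i, j}\<close> at \<open>i\<close> is at least two. So only the
  unit vector at \<open>i\<close> can fire the pair, and this requires \<open>missing j = {z}\<close> and
  \<open>missing i = {}\<close>. It then meets the baseline exactly and is harmless unless the pair is live,
  that is, unless \<open>{z, i, j}\<close> is dependent; in that case this triple is a circuit.\<close>

lemma blocked_half_pair:
  assumes ij: "i \<in> \<sigma>" "j \<in> \<sigma>" "i \<noteq> j" and mj: "missing j \<noteq> {}" and k: "k \<in> blocked {i, j}"
  shows "k = i \<and> spanned {i, j} \<noteq> {}"
proof -
  let ?a = "\<lambda>l. b \<sigma> l + unit_vec k l"
  have sub: "{i, j} \<subset> \<sigma>" using ij card3 card_mono[of "{i, j}" \<sigma>] by auto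
  have f: "can_be_fired M B0 {i, j} ?a" and no: "\<not> obeys F {i, j} ?a" using k by (auto simp: blocked_def)
  have fm: "finite (missing l)" for l using finite_B0 by (simp add: missing_def)
  have bi: "Suc (card (missing j)) \<le> (if i = k then 2 else 1)"
    using fired_unit[of "{i, j}" i k] sub f baseline_pair[OF ij] by auto
  have bj: "Suc (card (missing i)) \<le> (if j = k then 2 else 1)"
    using fired_unit[of "{i, j}" j k] sub f baseline_pair[OF ij(2,1)] ij(3) by (auto simp: insert_commute)
  have "card (missing j) > 0" using mj fm by (simp add: card_gt_0_iff)
  then have ki: "k = i" and "card (missing j) = 1" using bi by (auto split: if_splits)
  then obtain z where z: "missing j = {z}" by (auto simp: card_1_singleton_iff)
  have mi: "missing i = {}" using bj ki ij(3) fm by (auto split: if_splits)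
  have Uij: "U {i, j} = {z, i, j}" using U_pair[OF ij] z mi by auto
  have zB: "z \<in> B0" "z \<notin> C j" using z by (auto simp: missing_def)
  have "\<not> indep M {z, i, j}"
  proof
    assume "indep M {z, i, j}"
    then have d: "dead M B0 {i, j}" using ij \<sigma>_subset_R Uij by (auto simp: dead_iff)
    have sh: "fibre_shape M B0 {i, j} (F {i, j})" using inner[OF d sub] by (simp add: fibre_iff)
    have "?a l = b {i, j} l" if "l \<in> {i, j}" for l
    proof (cases "l = i")
      case True
      then show ?thesis using baseline_pair[OF ij] baseline_\<sigma>[OF ij(1)] z ki by (simp add: unit_vec_def)
    next
      case False
      then have "l = j" using that by simp
      then show ?thesis
        using baseline_pair[OF ij(2,1)] baseline_\<sigma>[OF ij(2)] mi ki ij(3) by (simp add: unit_vec_def insert_commute)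
    qed
    then have "obeys F {i, j} ?a" by (rule obeys_if_baseline[where F = F, OF d sh])
    then show False using no by contradiction
  qed
  moreover have "indep M {i, z}" by (rule indep_with_full_circuit[OF ij(1) mi zB(1)])
  moreover have "indep M {j, z}"
  proof (rule ccontr)
    assume "\<not> indep M {j, z}"
    then have "C j = {j, z}" by (rule parallel_pair[OF ij(2) zB(1)])
    then show False using zB(2) by blast
  qed
  ultimately have "circuit M {z, i, j}" by (intro circuit_triple ij zB(1))
  then show ?thesis using ki zB(1) by (auto simp: spanned_def)
qed

text \<open>If both circuits contain \<open>B0\<close>, the pair is dead with baseline one, and the unit vectors
  that it blocks are those missing from its fibre. The dead node has rank two on the four
  elements of \<open>B0\<close>, so with \<open>n\<close> non-loops its fibre has \<open>n - 2\<close> of the two unit vectors, and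
  \<open>4 - n\<close> are missing, as many as there are loops. A loop \<open>x\<close> of the node is spanned, because no
  pair \<open>{i, x}\<close> with \<open>i \<in> \<tau>\<close> is dependent.\<close>

lemma blocked_full_pair:
  assumes ij: "i \<in> \<sigma>" "j \<in> \<sigma>" "i \<noteq> j" and m: "missing i = {}" "missing j = {}"
  shows "card (blocked {i, j}) \<le> card (spanned {i, j})"
proof -
  let ?\<tau> = "{i, j}"
  have sub: "?\<tau> \<subset> \<sigma>" using ij card3 card_mono[of ?\<tau> \<sigma>] by auto
  have tR: "?\<tau> \<subseteq> R" using ij \<sigma>_subset_R by blast
  have Ut: "U ?\<tau> = ?\<tau>" using U_pair[OF ij] m by simp
  have d: "dead M B0 ?\<tau>"
    using tR ij(1,2) indep_mono[OF indep_\<sigma>, of ?\<tau>] by (simp add: dead_iff Ut)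
  have sh: "fibre_shape M B0 ?\<tau> (F ?\<tau>)" using inner[OF d sub] by (simp add: fibre_iff)
  have bt: "b ?\<tau> l = 1" if "l \<in> ?\<tau>" for l
    using that baseline_pair[OF ij] baseline_pair[OF ij(2,1)] ij(3) m by (auto simp: insert_commute)
  have rem: "(\<lambda>l. vec_restrict (\<lambda>l. b \<sigma> l + unit_vec k l) ?\<tau> l - b ?\<tau> l) = unit_vec k" if "k \<in> ?\<tau>" for k
  proof
    fix l show "vec_restrict (\<lambda>l. b \<sigma> l + unit_vec k l) ?\<tau> l - b ?\<tau> l = unit_vec k l"
      using that bt[of l] baseline_\<sigma>[of l] ij by (cases "l \<in> ?\<tau>") (auto simp: vec_restrict_def unit_vec_def)
  qed
  have bl: "blocked ?\<tau> \<subseteq> {k \<in> ?\<tau>. unit_vec k \<notin> F ?\<tau>}"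
  proof
    fix k assume k: "k \<in> blocked ?\<tau>"
    have kt: "k \<in> ?\<tau>"
    proof (rule ccontr)
      assume kt: "k \<notin> ?\<tau>"
      have "b \<sigma> l + unit_vec k l = b ?\<tau> l" if "l \<in> ?\<tau>" for l
        using that kt bt[OF that] baseline_\<sigma>[of l] sub by (auto simp: unit_vec_def)
      then have "obeys F ?\<tau> (\<lambda>l. b \<sigma> l + unit_vec k l)" by (rule obeys_if_baseline[where F = F, OF d sh])
      then show False using k by (simp add: blocked_def)
    qed
    then show "k \<in> {k \<in> ?\<tau>. unit_vec k \<notin> F ?\<tau>}"
      using k d rem[OF kt] by (simp add: blocked_def obeys_def)
  qed
  have B0A: "B0 \<subseteq> A ?\<tau>" using C_subset_A[OF _ tR, of i] m by (auto simp: missing_def)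
  have AU: "A ?\<tau> - ?\<tau> = B0" using A_minus_stratum[OF tR] B0A by blast
  have rk: "rank_of M (A ?\<tau>) = 4" using rank_A[OF tR] B0A B0_4 by (simp add: Int_absorb1)
  let ?N = "{x \<in> B0. indep M (insert x ?\<tau>)}" and ?D = "{x \<in> B0. \<not> indep M (insert x ?\<tau>)}"
  have "h_vector (dead_node M B0 ?\<tau>) 1 = int (card ?N) - 2"
    using h_vector_dead_node_1[OF d] AU ij(3) by (simp add: Ut rk)
  moreover have "degree_sequence ?\<tau> (F ?\<tau>) 1 = int (card {k \<in> ?\<tau>. unit_vec k \<in> F ?\<tau>})"
  proof -
    have "{a \<in> F ?\<tau>. sum a ?\<tau> = 1} = unit_vec ` {k \<in> ?\<tau>. unit_vec k \<in> F ?\<tau>}"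
    proof (intro equalityI subsetI)
      fix a assume a: "a \<in> {a \<in> F ?\<tau>. sum a ?\<tau> = 1}"
      then have "a i + a j = 1" using ij(3) by simp
      then consider "a i = 1" "a j = 0" | "a i = 0" "a j = 1" by linarith
      moreover have off: "a l = 0" if "l \<noteq> i" "l \<noteq> j" for l
        using a that fibre_shape_props(1)[OF sh] by (auto simp: monomials_def)
      ultimately have "a = unit_vec i \<or> a = unit_vec j"
      proof cases
        case 1
        then have "a l = unit_vec i l" for l
          using off[of l] by (cases "l = i"; cases "l = j") (auto simp: unit_vec_def)
        then show ?thesis by blast
      next
        case 2
        then have "a l = unit_vec j l" for l
          using off[of l] by (cases "l = i"; cases "l = j") (auto simp: unit_vec_def)
        then show ?thesis by blast
      qed
      then show "a \<in> unit_vec ` {k \<in> ?\<tau>. unit_vec k \<in> F ?\<tau>}" using a by auto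
    next
      fix a assume "a \<in> unit_vec ` {k \<in> ?\<tau>. unit_vec k \<in> F ?\<tau>}"
      then show "a \<in> {a \<in> F ?\<tau>. sum a ?\<tau> = 1}" using sum_unit_vec[of ?\<tau>] by auto
    qed
    then show ?thesis by (simp add: degree_sequence_def card_image[OF inj_unit_vec])
  qed
  ultimately have "card ?N = card {k \<in> ?\<tau>. unit_vec k \<in> F ?\<tau>} + 2"
    using fibre_shape_props(5)[OF sh] by simp
  moreover have "card ?N + card ?D = 4"
    using card_Un_disjoint[of ?N ?D] finite_B0 B0_4 by (simp add: Un_def Int_def conj_disj_distribL[symmetric])
  moreover have "card {k \<in> ?\<tau>. unit_vec k \<in> F ?\<tau>} + card {k \<in> ?\<tau>. unit_vec k \<notin> F ?\<tau>} = card ?\<tau>"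
    by (subst card_Un_disjoint[symmetric]) (auto intro: arg_cong[where f = card])
  moreover have "card ?\<tau> = 2" using ij(3) by simp
  ultimately have "card {k \<in> ?\<tau>. unit_vec k \<notin> F ?\<tau>} = card ?D" by linarith
  moreover have "card (blocked ?\<tau>) \<le> card {k \<in> ?\<tau>. unit_vec k \<notin> F ?\<tau>}"
    by (rule card_mono[OF _ bl]) simp
  moreover have "?D \<subseteq> spanned ?\<tau>"
  proof
    fix x assume x: "x \<in> ?D"
    have "circuit M {x, i, j}"
      using x by (intro circuit_triple ij indep_with_full_circuit m) auto
    then show "x \<in> spanned ?\<tau>" using x by (simp add: spanned_def)
  qed
  then have "card ?D \<le> card (spanned ?\<tau>)" by (rule card_mono[OF finite_spanned])
  ultimately show ?thesis by simp
qed

lemma blocked_pair: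
  assumes ij: "i \<in> \<sigma>" "j \<in> \<sigma>" "i \<noteq> j"
  shows "card (blocked {i, j}) \<le> card (spanned {i, j})"
proof (cases "missing i = {} \<and> missing j = {}")
  case True
  then show ?thesis using blocked_full_pair[OF ij] by blast
next
  case False
  have "\<exists>l. \<forall>k\<in>blocked {i, j}. k = l \<and> spanned {i, j} \<noteq> {}"
  proof (cases "missing j = {}")
    case True
    then have "missing i \<noteq> {}" using False by blast
    then show ?thesis using blocked_half_pair[OF ij(2,1)] ij(3) by (metis insert_commute)
  next
    case mj: False
    then show ?thesis using blocked_half_pair[OF ij] by metis
  qed
  then obtain l where l: "\<And>k. k \<in> blocked {i, j} \<Longrightarrow> k = l \<and> spanned {i, j} \<noteq> {}" by blast
  show ?thesis
  proof (cases "blocked {i, j} = {}")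
    case False
    then have "spanned {i, j} \<noteq> {}" using l by blast
    then have "1 \<le> card (spanned {i, j})" using finite_spanned by (simp add: Suc_le_eq card_gt_0_iff)
    moreover have "card (blocked {i, j}) \<le> 1" using l card_mono[of "{l}" "blocked {i, j}"] by auto
    ultimately show ?thesis by simp
  qed simp
qed

lemma blocked_le_spanned:
  assumes "\<tau> \<noteq> {}" "\<tau> \<subset> \<sigma>"
  shows "card (blocked \<tau>) \<le> card (spanned \<tau>)"
proof -
  have "card \<tau> < 3" using psubset_card_mono[OF finite_\<sigma> assms(2)] card3 by simp
  moreover have "card \<tau> \<noteq> 0" using assms(1) finite_subset[OF psubset_imp_subset[OF assms(2)] finite_\<sigma>] by simp
  ultimately consider "card \<tau> = 1" | "card \<tau> = 2" by linarith
  then show ?thesis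
  proof cases
    case 1
    then show ?thesis using assms blocked_singleton by (auto simp: card_1_singleton_iff)
  next
    case 2
    then obtain i j where "\<tau> = {i, j}" "i \<noteq> j" by (auto simp: card_2_iff)
    then show ?thesis using assms blocked_pair[of i j] by blast
  qed
qed

text \<open>With \<open>q\<close> the number of elements of \<open>B0\<close> in the closure of \<open>\<sigma>\<close>, the fibre needs \<open>3 - q\<close> of
  the three unit vectors. At most \<open>q\<close> are blocked, since the sets \<open>spanned \<tau>\<close> are disjoint and
  lie in that closure.\<close>

theorem triple_fibre: "\<exists>S. fibre M B0 F \<sigma> S"
proof -
  let ?P = "{\<tau>. \<tau> \<noteq> {} \<and> \<tau> \<subset> \<sigma>}"
  let ?D = "{x \<in> B0. \<not> indep M (insert x \<sigma>)}" and ?N = "{x \<in> B0. indep M (insert x \<sigma>)}"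
  have finP: "finite ?P" by (rule finite_subset[of _ "Pow \<sigma>"]) (use finite_\<sigma> in auto)
  have "card (\<Union>\<tau>\<in>?P. blocked \<tau>) \<le> (\<Sum>\<tau>\<in>?P. card (blocked \<tau>))"
    by (rule card_UN_le[OF finP])
  also have "\<dots> \<le> (\<Sum>\<tau>\<in>?P. card (spanned \<tau>))"
    by (intro sum_mono blocked_le_spanned) auto
  also have "\<dots> = card (\<Union>\<tau>\<in>?P. spanned \<tau>)"
  proof (rule card_UN_disjoint[symmetric, OF finP])
    show "\<forall>\<tau>\<in>?P. finite (spanned \<tau>)" using finite_spanned by blast
    show "\<forall>\<tau>\<in>?P. \<forall>\<tau>'\<in>?P. \<tau> \<noteq> \<tau>' \<longrightarrow> spanned \<tau> \<inter> spanned \<tau>' = {}"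
    proof (intro ballI impI)
      fix \<tau> \<tau>' assume t: "\<tau> \<in> ?P" "\<tau>' \<in> ?P" "\<tau> \<noteq> \<tau>'"
      have False if x: "x \<in> spanned \<tau>" "x \<in> spanned \<tau>'" for x
      proof -
        have "insert x \<tau> = insert x \<tau>'"
          using x t by (intro circuit_unique[OF indep_\<sigma>, of _ x]) (auto simp: spanned_def)
        moreover have "x \<notin> \<sigma>" using x \<sigma>_subset_R by (auto simp: spanned_def)
        then have "x \<notin> \<tau>" "x \<notin> \<tau>'" using t by auto
        ultimately show False using t(3) by (simp add: insert_ident)
      qed
      then show "spanned \<tau> \<inter> spanned \<tau>' = {}" by blast
    qed
  qed
  also have "\<dots> \<le> card ?D"
  proof (rule card_mono)
    show "(\<Union>\<tau>\<in>?P. spanned \<tau>) \<subseteq> ?D"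
    proof (rule UN_least, rule subsetI)
      fix x \<tau> assume "\<tau> \<in> ?P" and x: "x \<in> spanned \<tau>"
      then have "insert x \<tau> \<subseteq> insert x \<sigma>" by blast
      then show "x \<in> ?D"
        using x circuit_not_subset_indep[of "insert x \<tau>"] by (auto simp: spanned_def)
    qed
  qed (use finite_B0 in simp)
  finally have few: "card (\<Union>\<tau>\<in>?P. blocked \<tau>) \<le> card ?D" .
  let ?h = "h_vector (dead_node M B0 \<sigma>)"
  have "?h 1 = int (card ?N) - 1"
    using h_vector_dead_node_1[OF dead, unfolded full, unfolded U_eq rank_A_\<sigma> card3] by simp
  moreover have "card ?N + card ?D = 4"
    using card_Un_disjoint[of ?N ?D] finite_B0 B0_4 by (simp add: Un_def Int_def conj_disj_distribL[symmetric])
  ultimately have h1: "?h 1 = 3 - int (card ?D)" by simp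
  let ?free = "\<sigma> - (\<Union>\<tau>\<in>?P. blocked \<tau>)"
  have "card \<sigma> \<le> card ?free + card (\<Union>\<tau>\<in>?P. blocked \<tau>)"
  proof -
    have "finite (\<Union>\<tau>\<in>?P. blocked \<tau>)"
      by (rule finite_subset[OF _ finite_\<sigma>]) (auto simp: blocked_def)
    then have "card \<sigma> \<le> card (?free \<union> (\<Union>\<tau>\<in>?P. blocked \<tau>))"
      using finite_\<sigma> by (intro card_mono) auto
    then show ?thesis using card_Un_le order_trans by blast
  qed
  then have "nat (?h 1) \<le> card ?free" using h1 few card3 by simp
  then obtain I where I: "I \<subseteq> ?free" "card I = nat (?h 1)"
    by (rule obtain_subset_with_card_n)
  let ?S = "insert (\<lambda>i. 0) (unit_vec ` I)"
  have I\<sigma>: "I \<subseteq> \<sigma>" using I(1) by blast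
  have "fibre M B0 F \<sigma> ?S"
  proof (rule fibreI[OF dead inner])
    show "fibre_shape M B0 \<sigma> ?S"
      unfolding fibre_shape_def
    proof (intro conjI ext)
      show "pure_multicomplex \<sigma> ?S" by (rule pure_multicomplex_linear[OF finite_\<sigma> I\<sigma>])
      fix k :: nat
      have "k = 0 \<or> k = 1 \<or> 1 < k" by linarith
      then show "degree_sequence \<sigma> ?S k = ?h k"
        using degree_sequence_linear[OF finite_\<sigma> I\<sigma>, of k] h_vector_dead_node_0[OF dead]
          h_vector_dead_node_nonneg[OF dead, of 1] I(2)
          h_vector_dead_node_above[OF dead, of k] rank_A_\<sigma> card3 by (auto simp: U_eq)
    qed
    fix m \<tau> assume m: "m \<in> ?S" "m \<noteq> (\<lambda>i. 0)" and \<tau>: "stratum M B0 \<tau>" "\<tau> \<subset> \<sigma>"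
      "can_be_fired M B0 \<tau> (\<lambda>i. b \<sigma> i + m i)"
    obtain k where k: "k \<in> I" "m = unit_vec k" using m by blast
    have "k \<notin> blocked \<tau>" using k(1) I(1) \<tau>(1,2) by (auto simp: stratum_iff)
    then show "obeys F \<tau> (\<lambda>i. b \<sigma> i + m i)"
      using \<tau>(3) k I\<sigma> by (auto simp: blocked_def)
  qed
  then show ?thesis by blast
qed

end

context matroid_with_basis
begin

theorem dead_triple_fibre:
  assumes d: "dead M B0 \<sigma>" and three: "card \<sigma> = 3" and rk: "rank M \<le> 4"
    and F: "\<And>\<tau>. dead M B0 \<tau> \<Longrightarrow> \<tau> \<subset> \<sigma> \<Longrightarrow> fibre M B0 F \<tau> (F \<tau>)"
  shows "\<exists>S. fibre M B0 F \<sigma> S"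
proof (cases "rank_of M (A \<sigma>) \<le> card (U \<sigma>)")
  case True
  then show ?thesis using fibre_rank_zero[OF d _ F] by blast
next
  case False
  have s: "\<sigma> \<subseteq> R" using d by (simp add: dead_iff)
  have "4 \<le> card (A \<sigma> - U \<sigma>)" using card_A_minus_U[OF d] three False by simp
  moreover have "card (A \<sigma> - U \<sigma>) \<le> card B0"
    by (rule card_mono[OF finite_B0 A_minus_U_subset_B0[OF s]])
  ultimately have "card B0 = 4" "card B0 \<le> card (A \<sigma> - U \<sigma>)" using card_B0 rk by auto
  then have full: "A \<sigma> - U \<sigma> = B0"
    by (intro card_seteq[OF finite_B0 A_minus_U_subset_B0[OF s]])
  interpret dead_triple M B0 \<sigma> F
    by unfold_locales (use d three \<open>card B0 = 4\<close> full F in auto)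
  show ?thesis by (rule triple_fibre)
qed

theorem rank_4_fibre_system:
  assumes rk: "rank M \<le> 4"
  shows "\<exists>F. fibre_system M B0 F"
proof (rule fibre_systemI)
  fix \<sigma> F assume d: "dead M B0 \<sigma>" and F: "\<And>\<tau>. dead M B0 \<tau> \<Longrightarrow> \<tau> \<subset> \<sigma> \<Longrightarrow> fibre M B0 F \<tau> (F \<tau>)"
  have s: "\<sigma> \<subseteq> R" "\<sigma> \<noteq> {}" using d by (auto simp: dead_iff)
  have le: "rank_of M (A \<sigma>) \<le> 4" using rank_mono[OF A_ground[of \<sigma>]] rk by simp
  have \<sigma>U: "card \<sigma> \<le> card (U \<sigma>)" by (rule card_mono[OF finite_U stratum_subset_U[OF s(1)]])
  have "card \<sigma> \<noteq> 0" using s finite_stratum by auto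
  moreover have "card \<sigma> \<noteq> 1" using d singleton_live by (auto simp: card_1_singleton_iff)
  ultimately consider "card \<sigma> = 2" | "card \<sigma> = 3" | "4 \<le> card \<sigma>" by linarith
  then show "\<exists>S. fibre M B0 F \<sigma> S"
  proof cases
    case 1
    then show ?thesis
      using dead_pair_unconditional_fibre[OF d 1 rk] unconditional_imp_fibre[OF _ F] by blast
  next
    case 2
    show ?thesis by (rule dead_triple_fibre[OF d 2 rk F])
  next
    case 3
    then have "rank_of M (A \<sigma>) \<le> card (U \<sigma>)" using le \<sigma>U by simp
    then show ?thesis using fibre_rank_zero[OF d _ F] by blast
  qed
qed

end

theorem theorem6p8:
  fixes M :: "'a matroid_data"
  assumes "matroid M" and "rank M \<le> 4"
  shows "(\<forall>B0. basis M B0 \<longrightarrow>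
            (\<forall>\<sigma>. dead M B0 \<sigma> \<and> card \<sigma> = 2 \<longrightarrow> (\<exists>S. unconditional_fibre M B0 \<sigma> S)) \<and>
            (\<forall>\<sigma> F. dead M B0 \<sigma> \<and> card \<sigma> = 3 \<and>
                   (\<forall>\<tau>. dead M B0 \<tau> \<and> \<tau> \<subset> \<sigma> \<longrightarrow> fibre M B0 F \<tau> (F \<tau>)) \<longrightarrow>
                 (\<exists>S. fibre M B0 F \<sigma> S)) \<and>
            (\<exists>F. fibre_system M B0 F))
       \<and> pure_O_sequence (h_vector M)"
proof (intro conjI allI impI)
  have based: "matroid_with_basis M B0" if "basis M B0" for B0
    using assms(1) that by (simp add: matroid_with_basis_def matroid_with_basis_axioms_def)
  fix B0 assume "basis M B0"
  then interpret matroid_with_basis M B0 by (rule based)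
  show "\<exists>F. fibre_system M B0 F" by (rule rank_4_fibre_system[OF assms(2)])
  show "\<exists>S. unconditional_fibre M B0 \<sigma> S" if "dead M B0 \<sigma> \<and> card \<sigma> = 2" for \<sigma>
    using that dead_pair_unconditional_fibre assms(2) by blast
  show "\<exists>S. fibre M B0 F \<sigma> S" if "dead M B0 \<sigma> \<and> card \<sigma> = 3 \<and>
      (\<forall>\<tau>. dead M B0 \<tau> \<and> \<tau> \<subset> \<sigma> \<longrightarrow> fibre M B0 F \<tau> (F \<tau>))" for \<sigma> F
    using that by (intro dead_triple_fibre[OF _ _ assms(2)]) auto
next
  interpret matroid M by (rule assms(1))
  obtain B0 where B0: "B0 \<subseteq> ground M" "indep M B0" "card B0 = rank M" by (rule rank_attained)
  have "basis M B0"
    unfolding basis_of_def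
  proof (intro conjI allI impI B0)
    fix I assume I: "I \<subseteq> ground M \<and> indep M I \<and> B0 \<subseteq> I"
    then have "card I \<le> card B0" using card_le_rank[of I "ground M"] B0(3) by simp
    then show "I = B0" using I indep_finite card_seteq by metis
  qed
  then interpret matroid_with_basis M B0 by unfold_locales
  show "pure_O_sequence (h_vector M)"
    using rank_4_fibre_system[OF assms(2)] fibre_system_imp_pure_O_sequence by blast
qed

end
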